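(* The Klein cubic graph $\Gamma'$ is both a $\{C_7\}_{P_2}$-UH graph and a $\{\vec{C}_7\}_{\vec{P}_2}$-UH digraph. Moreover, $\Gamma'$ has exactly $24$ (oriented) $7$-cycles. Filling each of these cycles with a $2$-cell yields an embedding of $\Gamma'$ in the closed orientable surface $T_3$ of genus $3$, and this embedding is the Klein map of type $\{7,3\}_8$.
   Context: The Klein cubic graph $\Gamma'$ is the $56$-vertex, $84$-edge cubic graph of girth $7$ that forms the $1$-skeleton of the Klein map. The Klein map is the regular map of type $\{7,3\}_8$: it has heptagonal faces, three faces at each vertex, and Petrie polygons of length $8$, and it lies on the orientable surface of genus $3$. $P_k$ denotes the path with $k$ vertices ($P_2$ is an edge) and $C_7$ the $7$-cycle. A graph is regarded as a digraph by replacing each edge by two oppositely oriented arcs. $\vec{C}_7$ is the oriented $7$-cycle and $\vec{P}_2$ a single arc. A (di)graph $G$ is $X$-UH if every isomorphism between two induced copies of $X$ in $G$ extends to an automorphism of $G$. For a subgraph $M$ of a graph $H$, $G$ is a $\{H\}_M$-UH graph if all of the following hold: - $G$ is $M$-UH and $H$-UH; - for every copy $H_0$ of $H$ in $G$ and every copy $M_0$ of $M$ in $H_0$, there is exactly one copy $H_1\neq H_0$ of $H$ in $G$ with $H_0\cap H_1=M_0$ (equal vertex sets and edge sets). For digraphs, $G$ is a $\{\vec{H}\}_{\vec{M}}$-UH digraph if all of the following hold: - $G$ is $\vec{M}$-UH and $\vec{H}$-UH; - for every copy $\vec{H}_0$ of $\vec{H}$ and every copy $\vec{M}_0$ of $\vec{M}$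 in $\vec{H}_0$, there is exactly one copy $\vec{H}_1\neq\vec{H}_0$ with $V(\vec{H}_0)\cap V(\vec{H}_1)=V(\vec{M}_0)$ and $A(\vec{H}_0)\cap\bar{A}(\vec{H}_1)=A(\vec{M}_0)$. Here $\bar{A}(\vec{H}_1)$ is the set of arcs of $\vec{H}_1$ with reversed orientation. *)

theory Defs
  imports "Graph_Theory.Graph_Theory" "HOL-Library.Extended_Nat"
begin

section \<open>Graphs, digraphs and ultrahomogeneity\<close>

text \<open>A simple graph is a symmetric loop-free digraph (\<open>pair_graph\<close>): every edge is
  represented by its two opposite arcs, so that a graph already is the digraph obtained from it.
  Subgraphs, and intersections of vertex and edge sets, are then those of digraphs.\<close>

definition map_graph :: "('a \<Rightarrow> 'b) \<Rightarrow> 'a pair_pre_digraph \<Rightarrow> 'b pair_pre_digraph" where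
  "map_graph f G = \<lparr> pverts = f ` pverts G, parcs = map_prod f f ` parcs G \<rparr>"

definition graph_iso :: "('a \<Rightarrow> 'b) \<Rightarrow> 'a pair_pre_digraph \<Rightarrow> 'b pair_pre_digraph \<Rightarrow> bool" where
  "graph_iso f G H \<longleftrightarrow> inj_on f (pverts G) \<and> map_graph f G = H"

abbreviation graph_aut :: "('a \<Rightarrow> 'a) \<Rightarrow> 'a pair_pre_digraph \<Rightarrow> bool" where
  "graph_aut f G \<equiv> graph_iso f G G"

definition copies :: "'b pair_pre_digraph \<Rightarrow> 'a pair_pre_digraph \<Rightarrow> 'a pair_pre_digraph set" where
  "copies X G = {H. subgraph (with_proj H) (with_proj G) \<and> (\<exists>f. graph_iso f X H)}"

definition dipath :: "nat \<Rightarrow> nat pair_pre_digraph" where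
  "dipath k = \<lparr> pverts = {..<k}, parcs = {(i, Suc i) | i. Suc i < k} \<rparr>"

definition dicycle :: "nat \<Rightarrow> nat pair_pre_digraph" where
  "dicycle k = \<lparr> pverts = {..<k}, parcs = {(i, Suc i mod k) | i. i < k} \<rparr>"

definition path_graph :: "nat \<Rightarrow> nat pair_pre_digraph" where
  "path_graph k = mk_symmetric (dipath k)"

definition cycle_graph :: "nat \<Rightarrow> nat pair_pre_digraph" where
  "cycle_graph k = mk_symmetric (dicycle k)"

definition edges :: "'a pair_pre_digraph \<Rightarrow> 'a set set" where
  "edges G = (\<lambda>(u, v). {u, v}) ` parcs G"

definition girth :: "'a pair_pre_digraph \<Rightarrow> enat" where
  "girth G = Inf (enat ` {k. 3 \<le> k \<and> copies (cycle_graph k) G \<noteq> {}})"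

text \<open>Inducedness is tested on underlying graphs. For a graph \<open>X\<close> this is ordinary inducedness.
  For an oriented \<open>X\<close> in a graph \<open>G\<close> it is the only non-void reading: a subdigraph of \<open>G\<close> that
  contains an arc but not its reverse is never arc-induced in the symmetric digraph \<open>G\<close>.
  Arc-induced copies are induced in the present sense as well.\<close>

definition induced_copies ::
    "'b pair_pre_digraph \<Rightarrow> 'a pair_pre_digraph \<Rightarrow> 'a pair_pre_digraph set" where
  "induced_copies X G =
     {H \<in> copies X G. induced_subgraph (mk_symmetric H) (mk_symmetric G)}"

definition UH :: "'b pair_pre_digraph \<Rightarrow> 'a pair_pre_digraph \<Rightarrow> bool" where
  "UH X G \<longleftrightarrow>
     (\<forall>H1 \<in> induced_copies X G. \<forall>H2 \<in> induced_copies X G. \<forall>f. graph_iso f H1 H2 \<longrightarrow>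
        (\<exists>g. graph_aut g G \<and> (\<forall>v \<in> pverts H1. g v = f v)))"

definition UH_graph ::
    "'h pair_pre_digraph \<Rightarrow> 'm pair_pre_digraph \<Rightarrow> 'a pair_pre_digraph \<Rightarrow> bool" where
  "UH_graph H M G \<longleftrightarrow> UH M G \<and> UH H G \<and>
     (\<forall>H0 \<in> copies H G. \<forall>M0 \<in> copies M H0.
        \<exists>!H1. H1 \<in> copies H G \<and> H1 \<noteq> H0 \<and>
          pverts H0 \<inter> pverts H1 = pverts M0 \<and> parcs H0 \<inter> parcs H1 = parcs M0)"

definition UH_digraph ::
    "'h pair_pre_digraph \<Rightarrow> 'm pair_pre_digraph \<Rightarrow> 'a pair_pre_digraph \<Rightarrow> bool" where
  "UH_digraph H M G \<longleftrightarrow> UH M G \<and> UH H G \<and>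
     (\<forall>H0 \<in> copies H G. \<forall>M0 \<in> copies M H0.
        \<exists>!H1. H1 \<in> copies H G \<and> H1 \<noteq> H0 \<and>
          pverts H0 \<inter> pverts H1 = pverts M0 \<and> parcs H0 \<inter> (parcs H1)\<inverse> = parcs M0)"

section \<open>Maps on closed surfaces\<close>

text \<open>A map is given by its 1-skeleton \<open>G\<close> and the set \<open>F\<close> of cycles of \<open>G\<close> that are filled with
  2-cells; so all maps considered have faces bounded by cycles (which is no restriction for
  heptagonal faces and girth 7). The 2-complex obtained by attaching the discs is a
  closed surface iff every edge lies on exactly two faces and every vertex link is a circle.
  The link of \<open>v\<close> has the neighbours of \<open>v\<close> as its vertices and the face corners at \<open>v\<close> as its
  edges; given the edge condition it is 2-regular, so it is a circle iff it is connected.\<close>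

definition corners :: "'a pair_pre_digraph set \<Rightarrow> 'a \<Rightarrow> ('a \<times> 'a) set" where
  "corners F v = {(u, w). u \<noteq> w \<and> (\<exists>f \<in> F. (u, v) \<in> parcs f \<and> (v, w) \<in> parcs f)}"

definition surface_map :: "'a pair_pre_digraph \<Rightarrow> 'a pair_pre_digraph set \<Rightarrow> bool" where
  "surface_map G F \<longleftrightarrow>
     pair_graph G \<and> Digraph_Component.connected G \<and> parcs G \<noteq> {} \<and>
     F \<subseteq> (\<Union>k\<in>{3..}. copies (cycle_graph k) G) \<and>
     (\<forall>a \<in> parcs G. card {f \<in> F. a \<in> parcs f} = 2) \<and>
     (\<forall>v \<in> pverts G. \<forall>u w. (v, u) \<in> parcs G \<longrightarrow> (v, w) \<in> parcs G \<longrightarrow> (u, w) \<in> (corners F v)\<^sup>*)"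

definition oriented_cycle :: "'a pair_pre_digraph \<Rightarrow> 'a pair_pre_digraph \<Rightarrow> bool" where
  "oriented_cycle D C \<longleftrightarrow> (\<exists>k\<ge>3. D \<in> copies (dicycle k) C) \<and> mk_symmetric D = C"

text \<open>Coherent orientation of the faces: the two faces at an edge traverse it in opposite
  directions, i.e. no arc is used by two faces.\<close>

definition orientable :: "'a pair_pre_digraph set \<Rightarrow> bool" where
  "orientable F \<longleftrightarrow>
     (\<exists>ori. (\<forall>f \<in> F. oriented_cycle (ori f) f) \<and>
        (\<forall>f \<in> F. \<forall>g \<in> F. f \<noteq> g \<longrightarrow> parcs (ori f) \<inter> parcs (ori g) = {}))"

definition orientable_map_of_genus ::
    "nat \<Rightarrow> 'a pair_pre_digraph \<Rightarrow> 'a pair_pre_digraph set \<Rightarrow> bool" where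
  "orientable_map_of_genus g G F \<longleftrightarrow> surface_map G F \<and> orientable F \<and>
     int (card (pverts G)) - int (card (edges G)) + int (card F) = 2 - 2 * int g"

definition map_aut ::
    "('a \<Rightarrow> 'a) \<Rightarrow> 'a pair_pre_digraph \<Rightarrow> 'a pair_pre_digraph set \<Rightarrow> bool" where
  "map_aut \<phi> G F \<longleftrightarrow> graph_aut \<phi> G \<and> map_graph \<phi> ` F = F"

text \<open>A flag (vertex, edge, face) is encoded as a face together with an arc on it:
  the tail of the arc is the vertex of the flag.\<close>

definition regular_map :: "'a pair_pre_digraph \<Rightarrow> 'a pair_pre_digraph set \<Rightarrow> bool" where
  "regular_map G F \<longleftrightarrow> surface_map G F \<and>
     (\<forall>f \<in> F. \<forall>g \<in> F. \<forall>(u, v) \<in> parcs f. \<forall>(u', v') \<in> parcs g.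
        \<exists>\<phi>. map_aut \<phi> G F \<and> \<phi> u = u' \<and> \<phi> v = v' \<and> map_graph \<phi> f = g)"

text \<open>Petrie polygons, traversed as infinite periodic walks: any two consecutive edges, but no three,
  belong to a common face. The length of the polygon is the least period.\<close>

definition petrie_walk :: "'a pair_pre_digraph set \<Rightarrow> (nat \<Rightarrow> 'a) \<Rightarrow> bool" where
  "petrie_walk F w \<longleftrightarrow>
     (\<forall>i. w i \<noteq> w (i + 2) \<and>
        (\<exists>f \<in> F. {(w i, w (i + 1)), (w (i + 1), w (i + 2))} \<subseteq> parcs f) \<and>
        \<not> (\<exists>f \<in> F. {(w i, w (i + 1)), (w (i + 1), w (i + 2)), (w (i + 2), w (i + 3))} \<subseteq> parcs f))"

definition has_period :: "(nat \<Rightarrow> 'a) \<Rightarrow> nat \<Rightarrow> bool" where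
  "has_period w n \<longleftrightarrow> 0 < n \<and> (\<forall>i. w (i + n) = w i)"

text \<open>Regular maps of type \<open>{p, q}\<^sub>r\<close>.\<close>

definition regular_map_of_type ::
    "nat \<Rightarrow> nat \<Rightarrow> nat \<Rightarrow> 'a pair_pre_digraph \<Rightarrow> 'a pair_pre_digraph set \<Rightarrow> bool" where
  "regular_map_of_type p q r G F \<longleftrightarrow> regular_map G F \<and>
     F \<subseteq> copies (cycle_graph p) G \<and>
     (\<forall>v \<in> pverts G. card {f \<in> F. v \<in> pverts f} = q) \<and>
     (\<forall>w. petrie_walk F w \<longrightarrow> has_period w r \<and> (\<forall>n<r. \<not> has_period w n))"

text \<open>Orientability and genus of the Klein map are not part of the definition.\<close>

abbreviation klein_map :: "'a pair_pre_digraph \<Rightarrow> 'a pair_pre_digraph set \<Rightarrow> bool" where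
  "klein_map \<equiv> regular_map_of_type 7 3 8"

definition klein_cubic_graph :: "'a pair_pre_digraph \<Rightarrow> bool" where
  "klein_cubic_graph G \<longleftrightarrow> pair_graph G \<and>
     card (pverts G) = 56 \<and> card (edges G) = 84 \<and>
     (\<forall>v \<in> pverts G. out_degree G v = 3) \<and> girth G = 7 \<and>
     (\<exists>F. klein_map G F)"

end

theory Submission
  imports Defs
begin

text \<open>In a cubic map of type \<open>{7, 3}\<^sub>8\<close> any three consecutive vertices of a path lie on exactly one face,
  so a path is described by telling at each inner edge whether it stays on the current face or crosses over.
  Faces close up after seven steps and Petrie polygons after eight. Starting with the seven vertices \<open>a i\<close>
  of one face, these two closing rules determine seven further classes of vertices \<open>b i, \<dots>, k i\<close>
  (indices modulo 7) together with all edges and all 24 faces between them. The resulting set of vertices is closed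
  under adjacency, so a fixed graph on 56 vertices is mapped onto \<open>\<Gamma>\<close>, and bijectively so because
  \<open>\<Gamma>\<close> has 56 vertices too.

  Since the labelling may start at any path of three vertices, two labellings differ by an automorphism.
  This makes \<open>\<Gamma>\<close> transitive on such paths, and applied to the fixed graph itself it yields the
  regularity of the model. By this transitivity the cycles of length at most 7 need only be enumerated through
  one path of the model, where the only one is a face. The faces of the model are coherently oriented.\<close>

section \<open>Cycles as lists of vertices\<close>

text \<open>\<open>klein_cubic_graph\<close> only lists properties, for vertices of any type, so
  uniqueness has to be derived before any computation can be used. Distinctness of the 56 labels is
  never examined class by class: two neighbours of a vertex share a face and so have different
  labels, which makes the labelling a covering of a connected graph, hence onto, and a map of 56
  labels onto 56 vertices is one-to-one.

  The eight classes come from a rotation of order 7 about a face, which shifts the indices. It fixes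
  three of the 24 faces, the heptagons on the classes \<open>a\<close>, \<open>f\<close> and
  \<open>k\<close>, and moves the other 21 in three orbits of 7; these orbits are the three families
  with mixed classes in \<open>labelling_families\<close>. The Petrie rule enters the labelling
  through one family of polygons only, which identifies the third neighbour of \<open>d i\<close>
  with \<open>g (i - 2)\<close>; everything else is forced by the faces.\<close>

definition cyc :: "'a list \<Rightarrow> 'a pair_pre_digraph" where
  "cyc xs = \<lparr> pverts = set xs, parcs = set (zip xs (rotate1 xs)) \<rparr>"

text \<open>Forgets the direction that \<open>cyc\<close> still carries: a heptagon is
  \<open>scyc\<close> of 14 lists, an oriented heptagon is \<open>cyc\<close> of 7.\<close>

abbreviation scyc :: "'a list \<Rightarrow> 'a pair_pre_digraph" where
  "scyc xs \<equiv> mk_symmetric (with_proj (cyc xs))"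

text \<open>In a well-formed graph the arcs put the vertices into \<open>G\<close> too, as every
  listed vertex is the tail of an arc.\<close>

definition cycle_in :: "'a pair_pre_digraph \<Rightarrow> 'a list \<Rightarrow> bool" where
  "cycle_in G xs \<longleftrightarrow> distinct xs \<and> parcs (cyc xs) \<subseteq> parcs G"

lemma pverts_cyc [simp]: "pverts (cyc xs) = set xs"
  by (simp add: cyc_def)

lemma parcs_mk_symmetric_with_proj:
  "parcs (mk_symmetric (with_proj G)) = parcs G \<union> (parcs G)\<inverse>"
  by (auto simp: parcs_mk_symmetric)

lemma map_graph_mk_symmetric:
  "map_graph f (mk_symmetric (with_proj G)) = mk_symmetric (with_proj (map_graph f G))"
proof -
  have "map_prod f f ` (parcs G)\<inverse> = (map_prod f f ` parcs G)\<inverse>"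
    by (force simp: image_iff)
  then show ?thesis
    by (intro pair_pre_digraph.equality)
      (simp_all add: map_graph_def parcs_mk_symmetric_with_proj image_Un)
qed

lemma map_graph_cyc: "map_graph f (cyc xs) = cyc (map f xs)"
  by (simp add: map_graph_def cyc_def rotate1_map zip_map_map map_prod_def)

lemma map_graph_scyc: "map_graph f (scyc xs) = scyc (map f xs)"
  by (simp add: map_graph_mk_symmetric map_graph_cyc)

lemma map_graph_comp: "map_graph f (map_graph g G) = map_graph (f \<circ> g) G"
  by (simp add: map_graph_def image_comp map_prod.comp)

lemma map_graph_cong:
  assumes "\<And>v. v \<in> pverts G \<Longrightarrow> f v = g v" "pair_wf_digraph G"
  shows "map_graph f G = map_graph g G"
proof -
  interpret pair_wf_digraph G by fact
  show ?thesis
    using assms(1) wellformed'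
    by (auto simp: map_graph_def intro!: image_cong)
qed

lemma dicycle_eq_cyc:
  assumes "0 < k"
  shows "dicycle k = cyc [0..<k]"
proof -
  have "rotate1 [0..<k] ! i = Suc i mod k" if "i < k" for i
    using that assms by (simp add: nth_rotate1)
  then have "parcs (cyc [0..<k]) = {(i, Suc i mod k) | i. i < k}"
    unfolding cyc_def set_zip pair_pre_digraph.simps by force
  then show ?thesis
    by (auto simp: dicycle_def intro!: pair_pre_digraph.equality)
qed

lemma in_set_imp_arc_cyc:
  assumes "x \<in> set xs"
  shows "\<exists>y. (x, y) \<in> parcs (cyc xs)"
proof -
  from assms obtain i where "i < length xs" "x = xs ! i" by (auto simp: in_set_conv_nth)
  then have "(x, rotate1 xs ! i) \<in> parcs (cyc xs)" by (auto simp: cyc_def set_zip)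
  then show ?thesis by blast
qed

lemma pair_wf_digraph_cyc: "pair_wf_digraph (cyc xs)"
  by unfold_locales (auto simp: cyc_def dest: set_zip_leftD set_zip_rightD)

lemma pair_wf_digraph_imp_wf_digraph: "pair_wf_digraph G \<Longrightarrow> wf_digraph (with_proj G)"
  by (simp add: wf_digraph_wp_iff)

lemma subgraph_with_proj_iff:
  "subgraph (with_proj H) (with_proj G) \<longleftrightarrow>
     pverts H \<subseteq> pverts G \<and> parcs H \<subseteq> parcs G \<and> pair_wf_digraph G \<and> pair_wf_digraph H"
  by (auto simp: subgraph_def wf_digraph_wp_iff)

text \<open>An isomorphism from the standard cycle is the same thing as the list of its values, and
  indexing into a list gives it back. From here on cycles are concrete lists.\<close>

lemma copies_dicycle:
  assumes "pair_wf_digraph G" "0 < k"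
  shows "copies (dicycle k) G = cyc ` {xs. length xs = k \<and> cycle_in G xs}"
proof -
  interpret pair_wf_digraph G by fact
  show ?thesis
  proof (intro equalityI subsetI)
    fix H assume "H \<in> copies (dicycle k) G"
    then obtain f where s: "subgraph (with_proj H) (with_proj G)" and f: "graph_iso f (dicycle k) H"
      by (auto simp: copies_def)
    have H: "H = cyc (map f [0..<k])"
      using f assms(2) by (simp add: graph_iso_def dicycle_eq_cyc map_graph_cyc)
    moreover have "distinct (map f [0..<k])"
      using f by (simp add: graph_iso_def dicycle_def distinct_map atLeast0LessThan)
    ultimately show "H \<in> cyc ` {xs. length xs = k \<and> cycle_in G xs}"
      using s by (auto simp: cycle_in_def subgraph_with_proj_iff intro!: image_eqI[of _ _ "map f [0..<k]"])
  next
    fix H assume "H \<in> cyc ` {xs. length xs = k \<and> cycle_in G xs}"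
    then obtain xs where xs: "H = cyc xs" "length xs = k" "distinct xs" "parcs (cyc xs) \<subseteq> parcs G"
      by (auto simp: cycle_in_def)
    have "set xs \<subseteq> pverts G" using xs(4) in_set_imp_arc_cyc wellformed' by fastforce
    moreover have "graph_iso ((!) xs) (dicycle k) H"
      using xs assms(2)
      by (auto simp: graph_iso_def dicycle_eq_cyc map_graph_cyc map_nth inj_on_def nth_eq_iff_index_eq)
    ultimately show "H \<in> copies (dicycle k) G"
      using xs pair_wf_digraph_cyc pair_wf_digraph_axioms by (auto simp: copies_def subgraph_with_proj_iff)
  qed
qed

lemma copies_cycle_graph:
  assumes "pair_sym_digraph G" "0 < k"
  shows "copies (cycle_graph k) G = scyc ` {xs. length xs = k \<and> cycle_in G xs}"
proof -
  interpret pair_sym_digraph G by fact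
  have sym: "(u, v) \<in> parcs G \<Longrightarrow> (v, u) \<in> parcs G" for u v
    using pair_sym_arcs by (auto simp: symmetric_def dest: symD)
  have cg: "graph_iso f (cycle_graph k) H \<longleftrightarrow> distinct (map f [0..<k]) \<and> H = scyc (map f [0..<k])" for f H
    using assms(2) by (auto simp: graph_iso_def cycle_graph_def dicycle_eq_cyc map_graph_scyc distinct_map)
  show ?thesis
  proof (intro equalityI subsetI)
    fix H assume "H \<in> copies (cycle_graph k) G"
    then obtain f where s: "subgraph (with_proj H) (with_proj G)" and f: "graph_iso f (cycle_graph k) H"
      by (auto simp: copies_def)
    then show "H \<in> scyc ` {xs. length xs = k \<and> cycle_in G xs}"
      by (auto simp: cg cycle_in_def subgraph_with_proj_iff parcs_mk_symmetric_with_proj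
          intro!: image_eqI[of _ _ "map f [0..<k]"])
  next
    fix H assume "H \<in> scyc ` {xs. length xs = k \<and> cycle_in G xs}"
    then obtain xs where xs: "H = scyc xs" "length xs = k" "distinct xs" "parcs (cyc xs) \<subseteq> parcs G"
      by (auto simp: cycle_in_def)
    have "set xs \<subseteq> pverts G" using xs(4) in_set_imp_arc_cyc wellformed' by fastforce
    moreover have "graph_iso ((!) xs) (cycle_graph k) H"
      using xs by (auto simp: cg map_nth)
    moreover have "parcs (scyc xs) \<subseteq> parcs G"
      using xs(4) sym by (auto simp: parcs_mk_symmetric_with_proj)
    moreover have "pair_wf_digraph (scyc xs)"
      by (intro wf_digraph.wellformed_mk_symmetric pair_wf_digraph_imp_wf_digraph pair_wf_digraph_cyc)
    ultimately show "H \<in> copies (cycle_graph k) G"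
      using xs pair_wf_digraph_axioms by (auto simp: copies_def subgraph_with_proj_iff)
  qed
qed

lemma copies_dipath2:
  assumes "H \<in> copies (dipath 2) G"
  obtains u v where "u \<noteq> v" "pverts H = {u, v}" "parcs H = {(u, v)}" "(u, v) \<in> parcs G"
proof -
  have e: "dipath 2 = \<lparr> pverts = {0, 1}, parcs = {(0, 1)} \<rparr>" by (auto simp: dipath_def)
  from assms obtain f where "subgraph (with_proj H) (with_proj G)" "graph_iso f (dipath 2) H"
    by (auto simp: copies_def)
  then show ?thesis
    using that[of "f 0" "f 1"] by (auto simp: e graph_iso_def map_graph_def subgraph_with_proj_iff)
qed

lemma copies_path_graph2:
  assumes "H \<in> copies (path_graph 2) G"
  obtains u v where "u \<noteq> v" "pverts H = {u, v}" "parcs H = {(u, v), (v, u)}" "(u, v) \<in> parcs G"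
proof -
  have e: "path_graph 2 = \<lparr> pverts = {0, 1}, parcs = {(0, 1), (1, 0)} \<rparr>"
    by (auto simp: path_graph_def dipath_def mk_symmetric_def)
  from assms obtain f where "subgraph (with_proj H) (with_proj G)" "graph_iso f (path_graph 2) H"
    by (auto simp: copies_def)
  then show ?thesis
    using that[of "f 0" "f 1"] by (auto simp: e graph_iso_def map_graph_def subgraph_with_proj_iff)
qed

section \<open>Rotation and reversal of lists of seven vertices\<close>

lemma length7E:
  assumes "length xs = 7"
  obtains a b c d e f g where "xs = [a, b, c, d, e, f, g]"
  using assms by (auto simp: eval_nat_numeral length_Suc_conv)

lemma parcs_cyc7:
  "parcs (cyc [a, b, c, d, e, f, g]) = {(a, b), (b, c), (c, d), (d, e), (e, f), (f, g), (g, a)}"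
  by (simp add: cyc_def)

lemma scyc7_rotate: "scyc [a, b, c, d, e, f, g] = scyc [b, c, d, e, f, g, a]"
  by (rule pair_pre_digraph.equality) (auto simp: parcs_mk_symmetric_with_proj parcs_cyc7)

lemma cyc7_rotate: "cyc [a, b, c, d, e, f, g] = cyc [b, c, d, e, f, g, a]"
  by (rule pair_pre_digraph.equality) (auto simp: parcs_cyc7)

lemma scyc7_rev: "scyc [a, b, c, d, e, f, g] = scyc [g, f, e, d, c, b, a]"
  by (rule pair_pre_digraph.equality) (auto simp: parcs_mk_symmetric_with_proj parcs_cyc7)

section \<open>Local structure of a map of type \<open>{7, 3}\<^sub>8\<close>\<close>

text \<open>The assumptions are such that the model can be tested against them by computation;
  girth, regularity and orientability become conclusions for every instance that is also connected
  with 56 vertices.\<close>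

locale klein_rules =
  fixes G :: "'a pair_pre_digraph" and F :: "'a pair_pre_digraph set"
  assumes graph: "pair_graph G"
    and cubic: "\<And>v. v \<in> pverts G \<Longrightarrow> out_degree G v = 3"
    and heptagons: "F \<subseteq> copies (cycle_graph 7) G"
    and two_faces: "\<And>a. a \<in> parcs G \<Longrightarrow> card {f \<in> F. a \<in> parcs f} = 2"
    and petrie: "\<And>w. petrie_walk F w \<Longrightarrow> has_period w 8"
begin

abbreviation adj :: "'a \<Rightarrow> 'a \<Rightarrow> bool" where
  "adj u v \<equiv> (u, v) \<in> parcs G"

abbreviation corner :: "'a \<Rightarrow> 'a \<Rightarrow> 'a \<Rightarrow> bool" where
  "corner u v w \<equiv> u \<noteq> w \<and> adj u v \<and> adj v w"

definition face :: "'a list \<Rightarrow> bool" where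
  "face xs \<longleftrightarrow> length xs = 7 \<and> cycle_in G xs \<and> scyc xs \<in> F"

text \<open>A path along the boundary of one face (\<open>fc\<close>) and a path that crosses from one face to another at
  its middle edge (\<open>zig\<close>).\<close>

definition fc :: "'a \<Rightarrow> 'a \<Rightarrow> 'a \<Rightarrow> 'a \<Rightarrow> bool" where
  "fc u v w x \<longleftrightarrow> (\<exists>p q r. face [u, v, w, x, p, q, r])"

definition zig :: "'a \<Rightarrow> 'a \<Rightarrow> 'a \<Rightarrow> 'a \<Rightarrow> bool" where
  "zig u v w x \<longleftrightarrow> corner u v w \<and> corner v w x \<and> \<not> fc u v w x"

lemma adj_sym: "adj u v \<Longrightarrow> adj v u"
  using graph by (auto simp: pair_graph_def pair_pseudo_graph_def pair_sym_digraph_def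
      pair_sym_digraph_axioms_def symmetric_def dest: symD)

lemma adj_irrefl: "\<not> adj u u"
  using graph by (auto simp: pair_graph_def pair_digraph_def pair_loopfree_digraph_def
      pair_loopfree_digraph_axioms_def)

lemma adj_verts: "adj u v \<Longrightarrow> u \<in> pverts G \<and> v \<in> pverts G"
  using graph by (auto simp: pair_graph_def pair_digraph_def pair_loopfree_digraph_def
      pair_wf_digraph_def)

lemma pair_sym_digraph: "pair_sym_digraph G"
  using graph by (simp add: pair_graph_def pair_pseudo_graph_def)

lemma pair_wf_digraph: "pair_wf_digraph G"
  using pair_sym_digraph by (simp add: pair_sym_digraph_def)

lemma card_nbrs: "v \<in> pverts G \<Longrightarrow> card {u. adj v u} = 3"
proof -
  assume "v \<in> pverts G"
  then have "card (out_arcs (with_proj G) v) = 3" using cubic by (simp add: out_degree_def)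
  moreover have "out_arcs (with_proj G) v = Pair v ` {u. adj v u}"
    by (auto simp: out_arcs_def)
  ultimately show ?thesis by (simp add: card_image inj_on_def)
qed

text \<open>A choice that depends on the three arguments only, so labels built from it repeat
  whenever the arguments do.\<close>

definition third_nbr :: "'a \<Rightarrow> 'a \<Rightarrow> 'a \<Rightarrow> 'a" where
  "third_nbr v u w = (SOME t. t \<noteq> u \<and> t \<noteq> w \<and> adj v t)"

lemma nbr_cases:
  assumes "adj v x" "adj v y" "adj v z" "x \<noteq> y" "x \<noteq> z" "y \<noteq> z" "adj v s"
  shows "s = x \<or> s = y \<or> s = z"
proof (rule ccontr)
  assume s: "\<not> ?thesis"
  have "card {u. adj v u} = 3" using assms(1) adj_verts card_nbrs by blast
  moreover from this have "finite {u. adj v u}" by (metis card.infinite zero_neq_numeral)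
  moreover have "{x, y, z, s} \<subseteq> {u. adj v u}" using assms by auto
  ultimately have "card {x, y, z, s} \<le> 3" by (metis card_mono)
  then show False using assms s by auto
qed

lemma third_nbr:
  assumes "adj v u" "adj v w" "u \<noteq> w"
  shows "third_nbr v u w \<noteq> u" "third_nbr v u w \<noteq> w" "adj v (third_nbr v u w)"
proof -
  have "card {u. adj v u} = 3" using assms(1) adj_verts card_nbrs by blast
  then have "\<not> {u. adj v u} \<subseteq> {u, w}"
    using card_mono[of "{u, w}" "{u. adj v u}"] assms(3) by auto
  then have "\<exists>t. t \<noteq> u \<and> t \<noteq> w \<and> adj v t" by blast
  then have "third_nbr v u w \<noteq> u \<and> third_nbr v u w \<noteq> w \<and> adj v (third_nbr v u w)"
    unfolding third_nbr_def by (rule someI_ex)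
  then show "third_nbr v u w \<noteq> u" "third_nbr v u w \<noteq> w" "adj v (third_nbr v u w)" by auto
qed

section \<open>Faces through given arcs and corners\<close>

lemma face_rotate:
  assumes "face [a, b, c, d, e, f, g]"
  shows "face [b, c, d, e, f, g, a]"
  using assms scyc7_rotate[of a b c d e f g] by (auto simp: face_def cycle_in_def parcs_cyc7)

lemma face_rev:
  assumes "face [a, b, c, d, e, f, g]"
  shows "face [g, f, e, d, c, b, a]"
  using assms scyc7_rev[of a b c d e f g] adj_sym by (auto simp: face_def cycle_in_def parcs_cyc7)

lemma face_adj:
  assumes "face [a, b, c, d, e, f, g]"
  shows "adj a b" "adj b c" "adj c d" "adj d e" "adj e f" "adj f g" "adj g a"
    "distinct [a, b, c, d, e, f, g]"
  using assms by (auto simp: face_def cycle_in_def parcs_cyc7)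

lemma parcs_scyc7: "parcs (scyc [a, b, c, d, e, f, g]) =
    {(a, b), (b, c), (c, d), (d, e), (e, f), (f, g), (g, a),
     (b, a), (c, b), (d, c), (e, d), (f, e), (g, f), (a, g)}"
  unfolding parcs_mk_symmetric_with_proj parcs_cyc7 by auto

text \<open>A face is a list only up to dihedral symmetry: the seven rotations of the list and of
  its reversal bring each of the 14 arcs to the front.\<close>

lemma face_through_arc:
  assumes "f \<in> F" "(u, v) \<in> parcs f"
  shows "\<exists>c d e p q. face [u, v, c, d, e, p, q] \<and> f = scyc [u, v, c, d, e, p, q]"
proof -
  from assms(1) heptagons obtain xs where xs: "length xs = 7" "cycle_in G xs" "f = scyc xs"
    using copies_cycle_graph[OF pair_sym_digraph, of 7] by auto
  obtain x0 x1 x2 x3 x4 x5 x6 where x: "xs = [x0, x1, x2, x3, x4, x5, x6]"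
    using xs(1) by (rule length7E)
  have r0: "face [x0, x1, x2, x3, x4, x5, x6]" "f = scyc [x0, x1, x2, x3, x4, x5, x6]"
    using xs x assms(1) by (auto simp: face_def)
  note r1 = face_rotate[OF r0(1)] r0(2)[unfolded scyc7_rotate[of x0]]
  note r2 = face_rotate[OF r1(1)] r1(2)[unfolded scyc7_rotate[of x1]]
  note r3 = face_rotate[OF r2(1)] r2(2)[unfolded scyc7_rotate[of x2]]
  note r4 = face_rotate[OF r3(1)] r3(2)[unfolded scyc7_rotate[of x3]]
  note r5 = face_rotate[OF r4(1)] r4(2)[unfolded scyc7_rotate[of x4]]
  note r6 = face_rotate[OF r5(1)] r5(2)[unfolded scyc7_rotate[of x5]]
  note s0 = face_rev[OF r0(1)] r0(2)[unfolded scyc7_rev[of x0]]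
  note s1 = face_rotate[OF s0(1)] s0(2)[unfolded scyc7_rotate[of x6]]
  note s2 = face_rotate[OF s1(1)] s1(2)[unfolded scyc7_rotate[of x5]]
  note s3 = face_rotate[OF s2(1)] s2(2)[unfolded scyc7_rotate[of x4]]
  note s4 = face_rotate[OF s3(1)] s3(2)[unfolded scyc7_rotate[of x3]]
  note s5 = face_rotate[OF s4(1)] s4(2)[unfolded scyc7_rotate[of x2]]
  note s6 = face_rotate[OF s5(1)] s5(2)[unfolded scyc7_rotate[of x1]]
  have "(u, v) \<in> {(x0, x1), (x1, x2), (x2, x3), (x3, x4), (x4, x5), (x5, x6), (x6, x0),
    (x1, x0), (x2, x1), (x3, x2), (x4, x3), (x5, x4), (x6, x5), (x0, x6)}"
    using assms(2) unfolding r0(2) parcs_scyc7 .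
  then consider "u = x0" "v = x1"
    | "u = x1" "v = x2"
    | "u = x2" "v = x3"
    | "u = x3" "v = x4"
    | "u = x4" "v = x5"
    | "u = x5" "v = x6"
    | "u = x6" "v = x0"
    | "u = x1" "v = x0"
    | "u = x2" "v = x1"
    | "u = x3" "v = x2"
    | "u = x4" "v = x3"
    | "u = x5" "v = x4"
    | "u = x6" "v = x5"
    | "u = x0" "v = x6"
    by auto
  then show ?thesis
  proof cases
    case 1
    with r0 show ?thesis by metis
  next
    case 2
    with r1 show ?thesis by metis
  next
    case 3
    with r2 show ?thesis by metis
  next
    case 4
    with r3 show ?thesis by metis
  next
    case 5
    with r4 show ?thesis by metis
  next
    case 6
    with r5 show ?thesis by metis
  next
    case 7
    with r6 show ?thesis by metis
  next
    case 8
    with s5 show ?thesis by metis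
  next
    case 9
    with s4 show ?thesis by metis
  next
    case 10
    with s3 show ?thesis by metis
  next
    case 11
    with s2 show ?thesis by metis
  next
    case 12
    with s1 show ?thesis by metis
  next
    case 13
    with s0 show ?thesis by metis
  next
    case 14
    with s6 show ?thesis by metis
  qed
qed

lemma face_through_corner:
  assumes "f \<in> F" "(u, v) \<in> parcs f" "(v, w) \<in> parcs f" "u \<noteq> w"
  shows "\<exists>d e p q. face [u, v, w, d, e, p, q] \<and> f = scyc [u, v, w, d, e, p, q]"
proof -
  obtain c d e p q where c: "face [u, v, c, d, e, p, q]" "f = scyc [u, v, c, d, e, p, q]"
    using face_through_arc[OF assms(1,2)] by blast
  have "w = c"
    using assms(3,4) face_adj(8)[OF c(1)] unfolding c(2) parcs_scyc7 by auto
  then show ?thesis using c by blast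
qed

lemma parcs_face_sym: "f \<in> F \<Longrightarrow> (u, v) \<in> parcs f \<Longrightarrow> (v, u) \<in> parcs f"
  using face_through_arc[of f u v] by (auto simp: parcs_scyc7)

text \<open>At a vertex with neighbours \<open>u, w, t\<close>, the numbers of faces through the three corners have pairwise
  sums 2, so each of them is 1.\<close>

lemma corner_face_ex1:
  assumes "corner u v w"
  shows "\<exists>!f. f \<in> F \<and> (u, v) \<in> parcs f \<and> (v, w) \<in> parcs f"
proof -
  define t where "t = third_nbr v u w"
  have t: "t \<noteq> u" "t \<noteq> w" "adj v t"
    using third_nbr[of v u w] assms adj_sym unfolding t_def by auto
  define E where "E = (\<lambda>x. {f \<in> F. (x, v) \<in> parcs f})"
  define C where "C = (\<lambda>x y. {f \<in> F. (x, v) \<in> parcs f \<and> (v, y) \<in> parcs f})"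
  have E2: "card (E x) = 2" if "adj x v" for x
    using two_faces[OF that] by (simp add: E_def)
  have CE: "C x y \<subseteq> E x" for x y by (auto simp: C_def E_def)
  have fin: "finite (C x y)" if "adj x v" for x y
    using E2[OF that] CE by (metis card.infinite finite_subset zero_neq_numeral)
  have sum: "card (C x y) + card (C x z) = 2"
    if xyz: "adj x v" "adj v y" "adj v z" "x \<noteq> y" "x \<noteq> z" "y \<noteq> z" for x y z
  proof -
    have "C x y \<inter> C x z = {}"
    proof -
      have False if "f \<in> C x y" "f \<in> C x z" for f
      proof -
        have f: "f \<in> F" "(x, v) \<in> parcs f" "(v, y) \<in> parcs f" "(v, z) \<in> parcs f"
          using that by (auto simp: C_def)
        obtain d e p q where g: "face [x, v, y, d, e, p, q]" "f = scyc [x, v, y, d, e, p, q]"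
          using face_through_corner[OF f(1,2,3) xyz(4)] by blast
        show False
          using f(4) face_adj(8)[OF g(1)] xyz unfolding g(2) parcs_scyc7 by auto
      qed
      then show ?thesis by blast
    qed
    moreover have "E x = C x y \<union> C x z"
    proof -
      have "f \<in> C x y \<union> C x z" if "f \<in> E x" for f
      proof -
        have f: "f \<in> F" "(x, v) \<in> parcs f" using that by (auto simp: E_def)
        obtain c d e p q where g: "face [x, v, c, d, e, p, q]" "f = scyc [x, v, c, d, e, p, q]"
          using face_through_arc[OF f] by blast
        have "c = x \<or> c = y \<or> c = z"
          using nbr_cases[of v x y z c] xyz adj_sym face_adj(2)[OF g(1)] by blast
        then have "c = y \<or> c = z" using face_adj(8)[OF g(1)] by auto
        then show ?thesis using f g(2) by (auto simp: C_def parcs_scyc7)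
      qed
      then show ?thesis using CE by blast
    qed
    ultimately show ?thesis
      using E2[OF xyz(1)] fin[OF xyz(1)] by (metis card_Un_disjoint)
  qed
  have sym: "C x y = C y x" for x y
    using parcs_face_sym by (auto simp: C_def)
  have "card (C u w) + card (C u t) = 2" "card (C w u) + card (C w t) = 2"
    "card (C t u) + card (C t w) = 2"
    using assms t adj_sym by (auto intro!: sum)
  then have "card (C u w) = 1"
    using sym[of w u] sym[of t u] sym[of t w] by simp
  then obtain f where "C u w = {f}" by (auto simp: card_1_singleton_iff)
  then have "\<And>h. h \<in> F \<and> (u, v) \<in> parcs h \<and> (v, w) \<in> parcs h \<longleftrightarrow> h = f"
    unfolding C_def by blast
  then show ?thesis by simp
qed

lemma face_ex:
  assumes "corner u v w"
  obtains d e p q where "face [u, v, w, d, e, p, q]"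
proof -
  obtain f where "f \<in> F" "(u, v) \<in> parcs f" "(v, w) \<in> parcs f"
    using corner_face_ex1[OF assms] by auto
  from face_through_corner[OF this] assms that show ?thesis by auto
qed

text \<open>Both lists denote the one face at the corner \<open>u, v, w\<close>; since its vertices
  are distinct, the arcs leave a single continuation after each pair of consecutive
  vertices.\<close>

lemma face_unique:
  assumes "face [u, v, w, d, e, p, q]" "face [u, v, w, d', e', p', q']"
  shows "d = d'" "e = e'" "p = p'" "q = q'"
proof -
  have c: "corner u v w" using face_adj[OF assms(1)] by auto
  have s: "parcs (scyc [u, v, w, d, e, p, q]) = parcs (scyc [u, v, w, d', e', p', q'])"
  proof -
    have "(u, v) \<in> parcs (scyc [u, v, w, d, e, p, q])" "(v, w) \<in> parcs (scyc [u, v, w, d, e, p, q])"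
      "(u, v) \<in> parcs (scyc [u, v, w, d', e', p', q'])" "(v, w) \<in> parcs (scyc [u, v, w, d', e', p', q'])"
      by (simp_all add: parcs_scyc7)
    moreover have "scyc [u, v, w, d, e, p, q] \<in> F" "scyc [u, v, w, d', e', p', q'] \<in> F"
      using assms by (simp_all add: face_def)
    ultimately show ?thesis using corner_face_ex1[OF c] by metis
  qed
  note D = face_adj(8)[OF assms(1)] face_adj(8)[OF assms(2)]
  have "(w, d') \<in> parcs (scyc [u, v, w, d, e, p, q])" by (subst s) (simp add: parcs_scyc7)
  then show d: "d = d'" using D unfolding parcs_scyc7 by auto
  have "(d, e') \<in> parcs (scyc [u, v, w, d, e, p, q])" by (subst s) (simp add: parcs_scyc7 d)
  then show e: "e = e'" using D d unfolding parcs_scyc7 by auto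
  have "(e, p') \<in> parcs (scyc [u, v, w, d, e, p, q])" by (subst s) (simp add: parcs_scyc7 e)
  then show p: "p = p'" using D d e unfolding parcs_scyc7 by auto
  have "(p, q') \<in> parcs (scyc [u, v, w, d, e, p, q])" by (subst s) (simp add: parcs_scyc7 p)
  then show "q = q'" using D d e p unfolding parcs_scyc7 by auto
qed

section \<open>Paths along a face and paths crossing over\<close>

lemma fc_corner: "fc u v w x \<Longrightarrow> corner u v w" "fc u v w x \<Longrightarrow> corner v w x" "fc u v w x \<Longrightarrow> u \<noteq> x"
  by (auto simp: fc_def dest: face_adj)

lemma fc_rev: "fc u v w x \<Longrightarrow> fc x w v u"
  unfolding fc_def by (meson face_rev face_rotate)

lemma fc_unique: "fc u v w x \<Longrightarrow> fc u v w y \<Longrightarrow> x = y"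
  unfolding fc_def using face_unique by blast

lemma fc_unique': "fc u v w x \<Longrightarrow> fc t v w x \<Longrightarrow> u = t"
  using fc_rev fc_unique by blast

lemma fc_ex: "corner u v w \<Longrightarrow> \<exists>x. fc u v w x"
  unfolding fc_def using face_ex by metis

text \<open>The two faces at the edge \<open>v w\<close> pair the two further neighbours of
  \<open>v\<close> with those of \<open>w\<close>, so one pair forces the other.\<close>

lemma fc_flip:
  assumes f: "fc u v w x" and t: "adj v t" "t \<noteq> u" "t \<noteq> w" and y: "adj w y" "y \<noteq> v" "y \<noteq> x"
  shows "fc t v w y"
proof -
  have c: "corner u v w" "corner v w x" using fc_corner[OF f] by auto
  have "corner t v w" using c t adj_sym by auto
  then obtain z where z: "fc t v w z" using fc_ex by blast
  have "z = v \<or> z = x \<or> z = y"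
    using nbr_cases[of w v x y z] c y fc_corner(2)[OF z] adj_sym by auto
  moreover have "z \<noteq> v" using fc_corner(2)[OF z] by metis
  moreover have "z \<noteq> x" using fc_unique'[OF f, of t] z t by blast
  ultimately show ?thesis using z by simp
qed

text \<open>Of the two ways on from \<open>w\<close>, exactly one stays on the face at
  \<open>u, v, w\<close>.\<close>

lemma zig_flip:
  assumes f: "zig u v w x" and y: "adj w y" "y \<noteq> v" "y \<noteq> x"
  shows "fc u v w y"
proof -
  have c: "corner u v w" "corner v w x" "\<not> fc u v w x" using f by (auto simp: zig_def)
  obtain z where z: "fc u v w z" using fc_ex c(1) by blast
  have "z = v \<or> z = x \<or> z = y"
    using nbr_cases[of w v x y z] c y fc_corner(2)[OF z] adj_sym by auto
  moreover have "z \<noteq> v" using fc_corner(2)[OF z] by metis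
  moreover have "z \<noteq> x" using z c(3) by blast
  ultimately show ?thesis using z by simp
qed

lemma fc_zig:
  assumes "fc u v w x" "adj w y" "y \<noteq> v" "y \<noteq> x"
  shows "zig u v w y"
  unfolding zig_def using assms fc_corner[OF assms(1)] fc_unique[OF assms(1), of y] by metis

lemma zig_rev: "zig u v w x \<Longrightarrow> zig x w v u"
  unfolding zig_def using fc_rev[of x w v u] adj_sym by metis

lemma zig_ex: "corner u v w \<Longrightarrow> \<exists>x. zig u v w x"
proof -
  assume "corner u v w"
  then obtain x where x: "fc u v w x" using fc_ex by blast
  have "zig u v w (third_nbr w v x)"
    using fc_zig[OF x] third_nbr[of w v x] fc_corner(2)[OF x] adj_sym[of v w] by metis
  then show ?thesis ..
qed

lemma zig_unique: "zig u v w x \<Longrightarrow> zig u v w y \<Longrightarrow> x = y"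
  using zig_flip[of u v w x y] unfolding zig_def by metis

text \<open>Three vertices fix a face and four overlapping steps name all seven of its vertices, so
  the closing edge from \<open>g\<close> to \<open>a\<close> comes for free.\<close>

lemma fc_chain:
  assumes "fc a b c d" "fc b c d e" "fc c d e f" "fc d e f g"
  shows "face [a, b, c, d, e, f, g]"
proof -
  obtain p q r where 1: "face [a, b, c, d, p, q, r]" using assms(1) by (auto simp: fc_def)
  note 2 = face_rotate[OF 1]
  then have "fc b c d p" by (auto simp: fc_def)
  then have p: "p = e" using assms(2) fc_unique by blast
  note 3 = face_rotate[OF 2]
  then have "fc c d p q" by (auto simp: fc_def)
  then have q: "q = f" using assms(3) fc_unique p by blast
  note 4 = face_rotate[OF 3]
  then have "fc d p q r" by (auto simp: fc_def)
  then have "r = g" using assms(4) fc_unique p q by blast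
  then show ?thesis using 1 p q by simp
qed

lemma face_fc: "face [a, b, c, d, e, f, g] \<Longrightarrow> fc a b c d"
  by (auto simp: fc_def)

text \<open>Eight vertices with five consecutive crossings fill a whole period of a Petrie polygon,
  so the three crossings that wrap around follow.\<close>

lemma petrie_closes:
  assumes z: "zig w0 w1 w2 w3" "zig w1 w2 w3 w4" "zig w2 w3 w4 w5" "zig w3 w4 w5 w6" "zig w4 w5 w6 w7"
  shows "zig w5 w6 w7 w0" "zig w6 w7 w0 w1" "zig w7 w0 w1 w2"
proof -
  \<comment> \<open>Petrie walks are infinite by definition, so the path is prolonged by choice. The
    state is three consecutive vertices because these determine the next crossing.\<close>
  define T where "T = rec_nat (w0, w1, w2) (\<lambda>_ (u, v, w). (v, w, SOME x. zig u v w x))"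
  define w where "w = (\<lambda>n. fst (T n))"
  have T0: "T 0 = (w0, w1, w2)" and TS: "T (Suc n) = (case T n of (u, v, w) \<Rightarrow> (v, w, SOME x. zig u v w x))" for n
    by (simp_all add: T_def)
  have c: "case T n of (u, v, w) \<Rightarrow> corner u v w" for n
  proof (induction n)
    case 0
    then show ?case using z(1) by (simp add: T0 zig_def)
  next
    case (Suc n)
    obtain u v w where t: "T n = (u, v, w)" by (cases "T n") auto
    then have "zig u v w (SOME x. zig u v w x)"
      using Suc zig_ex someI_ex[of "zig u v w"] by auto
    then have "corner v w (SOME x. zig u v w x)"
      unfolding zig_def[of u v w "SOME x. zig u v w x"] by blast
    then show ?case by (simp add: TS t)
  qed
  have T: "T n = (w n, w (n + 1), w (n + 2))" for n
    by (cases "T n") (simp add: w_def TS)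
  have wz: "zig (w n) (w (n + 1)) (w (n + 2)) (w (n + 3))" for n
  proof -
    have "w (n + 3) = (SOME x. zig (w n) (w (n + 1)) (w (n + 2)) x)"
      using T[of n] T[of "Suc n"] by (simp add: TS eval_nat_numeral)
    then show ?thesis
      using c[of n] zig_ex someI_ex[of "zig (w n) (w (n + 1)) (w (n + 2))"] by (simp add: T)
  qed
  have "petrie_walk F w"
    unfolding petrie_walk_def
  proof (intro allI conjI)
    fix i
    have zi: "zig (w i) (w (i + 1)) (w (i + 2)) (w (i + 3))" by (rule wz)
    then have ci: "corner (w i) (w (i + 1)) (w (i + 2))" and nf: "\<not> fc (w i) (w (i + 1)) (w (i + 2)) (w (i + 3))"
      and ne: "w (i + 1) \<noteq> w (i + 3)"
      by (auto simp: zig_def)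
    show "w i \<noteq> w (i + 2)" using ci by simp
    show "\<exists>f\<in>F. {(w i, w (i + 1)), (w (i + 1), w (i + 2))} \<subseteq> parcs f"
      using corner_face_ex1[OF ci] by auto
    show "\<not> (\<exists>f\<in>F. {(w i, w (i + 1)), (w (i + 1), w (i + 2)), (w (i + 2), w (i + 3))} \<subseteq> parcs f)"
    proof
      assume "\<exists>f\<in>F. {(w i, w (i + 1)), (w (i + 1), w (i + 2)), (w (i + 2), w (i + 3))} \<subseteq> parcs f"
      then obtain f where f: "f \<in> F" "(w i, w (i + 1)) \<in> parcs f" "(w (i + 1), w (i + 2)) \<in> parcs f"
        "(w (i + 2), w (i + 3)) \<in> parcs f" by auto
      obtain d e p q where g: "face [w i, w (i + 1), w (i + 2), d, e, p, q]"
        "f = scyc [w i, w (i + 1), w (i + 2), d, e, p, q]"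
        using face_through_corner[OF f(1-3)] ci by blast
      have "w (i + 3) = d"
        using f(4) face_adj(8)[OF g(1)] ne unfolding g(2) parcs_scyc7 by auto
      then show False using g(1) nf by (auto simp: fc_def)
    qed
  qed
  then have per: "w (i + 8) = w i" for i using petrie by (auto simp: has_period_def)
  have w012: "w 0 = w0" "w 1 = w1" "w 2 = w2" using T[of 0] T0 by (auto simp: numeral_2_eq_2)
  have e: "zig (w 0) (w 1) (w 2) (w 3)" "zig (w 1) (w 2) (w 3) (w 4)" "zig (w 2) (w 3) (w 4) (w 5)"
    "zig (w 3) (w 4) (w 5) (w 6)" "zig (w 4) (w 5) (w 6) (w 7)" "zig (w 5) (w 6) (w 7) (w 8)"
    "zig (w 6) (w 7) (w 8) (w 9)" "zig (w 7) (w 8) (w 9) (w 10)"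
    using wz[of 0] wz[of 1] wz[of 2] wz[of 3] wz[of 4] wz[of 5] wz[of 6] wz[of 7]
    by (simp_all add: eval_nat_numeral)
  \<comment> \<open>Crossings are unique, so the infinite walk runs through the given
    \<open>w3, ..., w7\<close>, and its period then brings it back to \<open>w0\<close>.\<close>
  have w3: "w 3 = w3" by (rule zig_unique[OF e(1)[unfolded w012] z(1)])
  have w4: "w 4 = w4" by (rule zig_unique[OF e(2)[unfolded w012 w3] z(2)])
  have w5: "w 5 = w5" by (rule zig_unique[OF e(3)[unfolded w012 w3 w4] z(3)])
  have w6: "w 6 = w6" by (rule zig_unique[OF e(4)[unfolded w3 w4 w5] z(4)])
  have w7: "w 7 = w7" by (rule zig_unique[OF e(5)[unfolded w4 w5 w6] z(5)])
  have w8: "w 8 = w0" "w 9 = w1" "w 10 = w2"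
    using per[of 0] per[of 1] per[of 2] w012 by (simp_all add: eval_nat_numeral)
  show "zig w5 w6 w7 w0" "zig w6 w7 w0 w1" "zig w7 w0 w1 w2"
    using e(6-8) unfolding w5 w6 w7 w8 by blast+
qed

end

section \<open>Labelling a neighbourhood of a face\<close>

context klein_rules begin

definition face_next :: "'a \<Rightarrow> 'a \<Rightarrow> 'a \<Rightarrow> 'a" where
  "face_next u v w = (SOME x. fc u v w x)"

lemma fc_face_next: "corner u v w \<Longrightarrow> fc u v w (face_next u v w)"
  unfolding face_next_def using fc_ex someI_ex[of "fc u v w"] by blast

text \<open>Integer indices let all shifts be written without reduction. Each \<open>b i\<close>
  points outwards from the face \<open>a\<close>, and \<open>c i\<close>, \<open>d i\<close> are the
  two vertices behind it; the shifts by 2 and 3 in the other classes are not chosen but forced by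
  the Petrie rule.\<close>

lemma labelling_families:
  fixes a :: "int \<Rightarrow> 'a"
  assumes A: "\<And>i. fc (a i) (a (i + 1)) (a (i + 2)) (a (i + 3))" and per: "\<And>i. a (i + 7) = a i"
  obtains b c d e f g k :: "int \<Rightarrow> 'a" where
    "\<And>i. b (i + 7) = b i" "\<And>i. c (i + 7) = c i" "\<And>i. d (i + 7) = d i" "\<And>i. e (i + 7) = e i"
    "\<And>i. f (i + 7) = f i" "\<And>i. g (i + 7) = g i" "\<And>i. k (i + 7) = k i"
    "\<And>i. face [a i, b i, d i, e i, c (i + 1), b (i + 1), a (i + 1)]"
    "\<And>i. face [k (i - 2), g (i - 2), d i, b i, c i, g i, k i]"
    "\<And>i. face [f i, e i, d i, g (i - 2), c (i - 2), e (i - 3), f (i - 3)]"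
    "\<And>i. face [f i, f (i - 3), f (i - 6), f (i - 9), f (i - 12), f (i - 15), f (i - 18)]"
    "\<And>i. face [k i, k (i - 2), k (i - 4), k (i - 6), k (i - 8), k (i - 10), k (i - 12)]"
proof -
  define b where "b = (\<lambda>i. third_nbr (a i) (a (i - 1)) (a (i + 1)))"
  define c where "c = (\<lambda>i. face_next (a (i - 1)) (a i) (b i))"
  define d where "d = (\<lambda>i. face_next (a (i + 1)) (a i) (b i))"
  define e where "e = (\<lambda>i. face_next (a (i + 1)) (b (i + 1)) (c (i + 1)))"
  define f where "f = (\<lambda>i. third_nbr (e i) (c (i + 1)) (d i))"
  define g where "g = (\<lambda>i. third_nbr (c i) (b i) (e (i - 1)))"
  \<comment> \<open>A provisional name for the third neighbour of \<open>d i\<close>, until it is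
    identified with \<open>g (i - 2)\<close>.\<close>
  define h where "h = (\<lambda>i. third_nbr (d i) (b i) (e i))"
  define k where "k = (\<lambda>i. third_nbr (g i) (c i) (d (i + 2)))"
  have A': "fc (a (i - 1)) (a i) (a (i + 1)) (a (i + 2))" for i
    using A[of "i - 1"] by (simp add: algebra_simps)
  have a: "adj (a i) (a (i - 1))" "adj (a i) (a (i + 1))" "a (i - 1) \<noteq> a (i + 1)"
    "a (i + 1) \<noteq> a (i - 1)" for i
    using fc_corner(1)[OF A', of i] adj_sym by metis+
  have b: "adj (a i) (b i)" "b i \<noteq> a (i - 1)" "b i \<noteq> a (i + 1)" for i
    using third_nbr[OF a(1-3), of i] unfolding b_def by auto
  have b': "adj (b i) (a i)" for i using b(1) adj_sym by blast
  have c: "fc (a (i - 1)) (a i) (b i) (c i)" for i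
    unfolding c_def using a b adj_sym by (intro fc_face_next) metis
  have d: "fc (a (i + 1)) (a i) (b i) (d i)" for i
    unfolding d_def using a b adj_sym by (intro fc_face_next) metis
  have bc: "adj (b i) (c i)" "c i \<noteq> a i" for i using fc_corner(2)[OF c, of i] by metis+
  have bd: "adj (b i) (d i)" "d i \<noteq> a i" for i using fc_corner(2)[OF d, of i] by metis+
  have ab: "fc (b i) (a i) (a (i + 1)) (b (i + 1))" for i
  proof (rule fc_flip[OF A'])
    show "b (i + 1) \<noteq> a i" "b (i + 1) \<noteq> a (i + 2)" "adj (a (i + 1)) (b (i + 1))"
      using b(1-3)[of "i + 1"] by (simp_all add: algebra_simps)
  qed (use b[of i] in \<open>auto simp: algebra_simps\<close>)
  have c': "fc (a i) (a (i + 1)) (b (i + 1)) (c (i + 1))" for i using c[of "i + 1"] by (simp add: algebra_simps)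
  have e: "fc (a (i + 1)) (b (i + 1)) (c (i + 1)) (e i)" for i
    unfolding e_def using fc_corner(2)[OF c', of i] by (intro fc_face_next) metis
  have T1: "face [d i, b i, a i, a (i + 1), b (i + 1), c (i + 1), e i]" for i
    by (rule fc_chain[OF fc_rev[OF d] ab c' e])
  note T1' = face_rotate[OF T1]
  note T1'' = face_rotate[OF T1']
  note T1''' = face_rotate[OF T1'']
  note T1a = face_rotate[OF T1''']
  note T1r = face_rev[OF T1]
  \<comment> \<open>Reversed, so that the edge between \<open>a i\<close> and
    \<open>a (i + 1)\<close> is traversed against the face \<open>a\<close>, as in the coherent
    orientation of the model.\<close>
  have T1s: "face [a i, b i, d i, e i, c (i + 1), b (i + 1), a (i + 1)]" for i
    by (rule face_rotate[OF face_rotate[OF face_rotate[OF face_rotate[OF T1r]]]])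
  have cd: "c i \<noteq> d i" for i
  proof
    assume "c i = d i"
    then have "a (i - 1) = a (i + 1)" using fc_unique'[OF c d[of i, folded \<open>c i = d i\<close>]] by simp
    then show False using a by blast
  qed
  have be: "b i \<noteq> e (i - 1)" "adj (c i) (b i)" "adj (c i) (e (i - 1))" for i
    using face_adj[OF T1, of "i - 1"] adj_sym by auto
  have bde: "b i \<noteq> e i" "adj (d i) (b i)" "adj (d i) (e i)" for i
    using face_adj[OF T1, of i] adj_sym by auto
  have g: "g i \<noteq> b i" "g i \<noteq> e (i - 1)" "adj (c i) (g i)" for i
    unfolding g_def using third_nbr[OF be(2,3,1), of i] by auto
  have h: "h i \<noteq> b i" "h i \<noteq> e i" "adj (d i) (h i)" for i
    unfolding h_def using third_nbr[OF bde(2,3,1), of i] by auto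
  have z1: "zig (g i) (c i) (b i) (a i)" for i
  proof (rule zig_rev, rule fc_zig)
    show "fc (a i) (b i) (c i) (e (i - 1))" using e[of "i - 1"] by (simp add: algebra_simps)
  qed (use g[of i] in \<open>auto simp: algebra_simps\<close>)
  have z2: "zig (c i) (b i) (a i) (a (i + 1))" for i
    by (rule fc_zig[OF fc_rev[OF c]]) (use a[of i] b[of i] in metis)+
  have z3: "zig (b i) (a i) (a (i + 1)) (a (i + 2))" for i
    by (rule fc_zig[OF ab]) (use a[of "i + 1"] b[of "i + 1"] in \<open>auto simp: algebra_simps\<close>)
  have z4: "zig (a i) (a (i + 1)) (a (i + 2)) (b (i + 2))" for i
    by (rule fc_zig[OF A]) (use b[of "i + 2"] in \<open>auto simp: algebra_simps\<close>)
  have z5: "zig (a i) (a (i + 1)) (b (i + 1)) (d (i + 1))" for i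
    by (rule fc_zig[OF c']) (use bd[of "i + 1"] cd[of "i + 1"] in \<open>auto simp: algebra_simps\<close>)
  have z6: "zig (a i) (b i) (d i) (h i)" for i
    by (rule fc_zig[OF face_fc[OF T1s]]) (use h[of i] in \<open>auto simp: algebra_simps\<close>)
  have z5': "zig (a (i + 1)) (a (i + 2)) (b (i + 2)) (d (i + 2))" for i
    using z5[of "i + 1"] by (simp add: algebra_simps)
  \<comment> \<open>The polygon \<open>g i, c i, b i, a i, a (i + 1), a (i + 2), b (i + 2), d (i +
    2)\<close> runs along two edges of the face \<open>a\<close>. Its closing makes
    \<open>g i\<close> a neighbour of \<open>d (i + 2)\<close>, which is the origin of the shift by
    2.\<close>
  note P = petrie_closes[OF z1 z2 z3 z4 z5']
  have P1: "zig (a i) (b i) (d i) (g (i - 2))" "zig (b i) (d i) (g (i - 2)) (c (i - 2))"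
    "zig (d i) (g (i - 2)) (c (i - 2)) (b (i - 2))" for i
    using P[of "i - 2"] by (simp_all add: algebra_simps)
  have hg: "h i = g (i - 2)" for i using zig_unique[OF z6 P1(1)] .
  have dg: "adj (d i) (g (i - 2))" "g (i - 2) \<noteq> b i" "g (i - 2) \<noteq> e i" for i
    using h[of i] unfolding hg by auto
  have gcd: "adj (g i) (c i)" "adj (g i) (d (i + 2))" "c i \<noteq> d (i + 2)" for i
    using P1(2)[of "i + 2"] adj_sym unfolding zig_def by (auto)
  have k: "k i \<noteq> c i" "k i \<noteq> d (i + 2)" "adj (g i) (k i)" for i
    unfolding k_def using third_nbr[OF gcd, of i] by auto
  have k2: "k (i - 2) \<noteq> c (i - 2)" "k (i - 2) \<noteq> d i" "adj (g (i - 2)) (k (i - 2))" for i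
    using k[of "i - 2"] by auto
  have K1: "fc (b i) (d i) (g (i - 2)) (k (i - 2))" for i
    by (rule zig_flip[OF P1(2)]) (use k2[of i] in \<open>auto simp: algebra_simps\<close>)
  have K2: "fc (b i) (c i) (g i) (k i)" for i
  proof (rule zig_flip)
    show "zig (b i) (c i) (g i) (d (i + 2))" using zig_rev[OF P1(3)[of "i + 2"]] by (simp add: algebra_simps)
  qed (use k[of i] in \<open>auto simp: algebra_simps\<close>)
  have K3: "fc (c i) (b i) (d i) (g (i - 2))" for i
  proof (rule fc_flip)
    show "fc (a i) (b i) (d i) (e i)"
      by (rule face_fc[OF T1s])
  qed (use bc[of i] cd[of i] dg[of i] in \<open>auto simp: algebra_simps\<close>)
  have K4: "fc (g i) (c i) (b i) (d i)" for i
  proof (rule fc_flip)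
    show "fc (e (i - 1)) (c i) (b i) (a i)" using fc_rev[OF e[of "i - 1"]] by (simp add: algebra_simps)
  qed (use g[of i] bd[of i] cd[of i] in \<open>auto simp: algebra_simps\<close>)
  \<comment> \<open>The face in the corner of \<open>b i\<close> that avoids \<open>a i\<close>. Its
    closing edge joins \<open>k i\<close> to \<open>k (i - 2)\<close>.\<close>
  have T2: "face [k (i - 2), g (i - 2), d i, b i, c i, g i, k i]" for i
    by (rule fc_chain[OF fc_rev[OF K1] fc_rev[OF K3] fc_rev[OF K4] K2])
  have ecd: "adj (e i) (c (i + 1))" "adj (e i) (d i)" "c (i + 1) \<noteq> d i" for i
    using face_adj[OF T1, of i] adj_sym by auto
  have f: "f i \<noteq> c (i + 1)" "f i \<noteq> d i" "adj (e i) (f i)" for i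
    unfolding f_def using third_nbr[OF ecd, of i] by auto
  have M1: "fc (g (i - 2)) (d i) (e i) (f i)" for i
  proof (rule fc_flip)
    show "fc (b i) (d i) (e i) (c (i + 1))"
      by (rule face_fc[OF face_rotate[OF T1s]])
  qed (use dg[of i] f[of i] in \<open>auto simp: algebra_simps\<close>)
  have M2: "fc (e i) (d i) (g (i - 2)) (c (i - 2))" for i
    by (rule fc_flip[OF K1]) (use bde[of i] dg[of i] k2[of i] gcd[of "i - 2"] in \<open>auto simp: algebra_simps\<close>)
  have M3: "fc (d i) (g (i - 2)) (c (i - 2)) (e (i - 3))" for i
    by (rule zig_flip[OF P1(3)]) (use be[of "i - 2"] dg[of i] g[of "i - 2"] in \<open>auto simp: algebra_simps\<close>)
  have M4: "fc (g i) (c i) (e (i - 1)) (f (i - 1))" for i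
  proof (rule fc_flip)
    show "fc (b i) (c i) (e (i - 1)) (d (i - 1))"
      using face_fc[OF T1a, of "i - 1"] by simp
  qed (use g[of i] f[of "i - 1"] in \<open>auto simp: algebra_simps\<close>)
  have M4': "fc (g (i - 2)) (c (i - 2)) (e (i - 3)) (f (i - 3))" for i
    using M4[of "i - 2"] by (simp add: algebra_simps)
  \<comment> \<open>The face across the edge \<open>d i, e i\<close> from \<open>T1\<close>. Its
    closing edge joins \<open>f i\<close> to \<open>f (i - 3)\<close>.\<close>
  have T3: "face [f i, e i, d i, g (i - 2), c (i - 2), e (i - 3), f (i - 3)]" for i
    by (rule fc_chain[OF fc_rev[OF M1] M2 M3 M4'])
  have T2c: "fc (d i) (g (i - 2)) (k (i - 2)) (k i)" for i
    using face_fc[OF face_rotate[OF face_rotate[OF face_rotate[OF face_rotate[OF face_rev[OF T2[of i]]]]]]] .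
  have T2d: "fc (c i) (g i) (k i) (k (i - 2))" "fc (g i) (k i) (k (i - 2)) (g (i - 2))" for i
    using face_fc[OF face_rotate[OF face_rotate[OF face_rotate[OF face_rotate[OF T2[of i]]]]]]
      face_fc[OF face_rotate[OF face_rotate[OF face_rotate[OF face_rotate[OF face_rotate[OF T2[of i]]]]]]]
    by auto
  \<comment> \<open>The faces \<open>T2\<close> for \<open>i\<close> and for \<open>i + 2\<close>
    meet at the edge \<open>g i, k i\<close> and continue to \<open>k (i - 2)\<close> and
    \<open>k (i + 2)\<close>; if these were equal, so would be \<open>c i\<close> and
    \<open>d (i + 2)\<close> at the other end. The same argument with \<open>T3\<close> serves
    \<open>f\<close> below.\<close>
  have kk: "k (i + 2) \<noteq> k (i - 2)" "k (i + 2) \<noteq> g i" "adj (k i) (k (i + 2))" for i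
  proof -
    have 1: "fc (d (i + 2)) (g i) (k i) (k (i + 2))" using T2c[of "i + 2"] by (simp add: algebra_simps)
    show "k (i + 2) \<noteq> k (i - 2)"
    proof
      assume "k (i + 2) = k (i - 2)"
      then have "c i = d (i + 2)" using fc_unique'[OF T2d(1) 1[unfolded \<open>k (i + 2) = k (i - 2)\<close>]] by simp
      then show False using gcd by blast
    qed
    show "k (i + 2) \<noteq> g i" "adj (k i) (k (i + 2))" using fc_corner(2)[OF 1] by metis+
  qed
  have kk': "k (i - 4) \<noteq> k i" "k (i - 4) \<noteq> g (i - 2)" "adj (k (i - 2)) (k (i - 4))" for i
    using kk(1)[of "i - 2"] fc_corner(2)[OF T2d(1), of "i - 2"] by (auto simp: algebra_simps)
  have K: "fc (k (i + 2)) (k i) (k (i - 2)) (k (i - 4))" for i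
    by (rule fc_flip[OF T2d(2)]) (use kk[of i] kk'[of i] in \<open>auto simp: algebra_simps\<close>)
  have K': "fc (k i) (k (i - 2)) (k (i - 4)) (k (i - 6))" for i
    using K[of "i - 2"] by (simp add: algebra_simps)
  have KK: "face [k i, k (i - 2), k (i - 4), k (i - 6), k (i - 8), k (i - 10), k (i - 12)]" for i
    using fc_chain[OF K', of i "k (i - 8)" "k (i - 10)" "k (i - 12)"] K'[of "i - 2"] K'[of "i - 4"] K'[of "i - 6"]
    by (simp add: algebra_simps)
  have T3c: "fc (c (i - 2)) (e (i - 3)) (f (i - 3)) (f i)" for i
    by (rule face_fc[OF face_rotate[OF face_rotate[OF face_rotate[OF face_rotate[OF T3[of i]]]]]])
  have T3d: "fc (d i) (e i) (f i) (f (i - 3))" "fc (e i) (f i) (f (i - 3)) (e (i - 3))" for i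
    using fc_rev[OF face_fc[OF face_rotate[OF face_rotate[OF face_rotate[OF face_rotate[OF face_rotate[OF face_rotate[OF T3[of i]]]]]]]]]
      fc_rev[OF face_fc[OF face_rotate[OF face_rotate[OF face_rotate[OF face_rotate[OF face_rotate[OF T3[of i]]]]]]]]
    by auto
  have ff: "f (i + 3) \<noteq> f (i - 3)" "f (i + 3) \<noteq> e i" "adj (f i) (f (i + 3))" for i
  proof -
    have 1: "fc (c (i + 1)) (e i) (f i) (f (i + 3))" using T3c[of "i + 3"] by (simp add: algebra_simps)
    show "f (i + 3) \<noteq> f (i - 3)"
    proof
      assume "f (i + 3) = f (i - 3)"
      then have "d i = c (i + 1)" using fc_unique'[OF T3d(1) 1[unfolded \<open>f (i + 3) = f (i - 3)\<close>]] by simp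
      then show False using ecd by metis
    qed
    show "f (i + 3) \<noteq> e i" "adj (f i) (f (i + 3))" using fc_corner(2)[OF 1] by metis+
  qed
  have ff': "f (i - 6) \<noteq> f i" "f (i - 6) \<noteq> e (i - 3)" "adj (f (i - 3)) (f (i - 6))" for i
    using ff(1)[of "i - 3"] fc_corner(2)[OF T3d(1), of "i - 3"] by (auto simp: algebra_simps)
  have M: "fc (f (i + 3)) (f i) (f (i - 3)) (f (i - 6))" for i
    by (rule fc_flip[OF T3d(2)]) (use ff[of i] ff'[of i] in \<open>auto simp: algebra_simps\<close>)
  have M': "fc (f i) (f (i - 3)) (f (i - 6)) (f (i - 9))" for i
    using M[of "i - 3"] by (simp add: algebra_simps)
  have FF: "face [f i, f (i - 3), f (i - 6), f (i - 9), f (i - 12), f (i - 15), f (i - 18)]" for i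
    using fc_chain[OF M', of i "f (i - 12)" "f (i - 15)" "f (i - 18)"] M'[of "i - 3"] M'[of "i - 6"] M'[of "i - 9"]
    by (simp add: algebra_simps)
  \<comment> \<open>Every class is a choice function applied to earlier labels, so the period 7 of
    \<open>a\<close> is inherited from class to class.\<close>
  have sh: "i + 7 - 1 = i - 1 + 7" "i + 7 + 1 = i + 1 + 7" "i + 7 + 2 = i + 2 + 7" for i :: int
    by simp_all
  have pb: "b (i + 7) = b i" for i unfolding b_def sh per ..
  have pc: "c (i + 7) = c i" for i unfolding c_def sh per pb ..
  have pd: "d (i + 7) = d i" for i unfolding d_def sh per pb ..
  have pe: "e (i + 7) = e i" for i unfolding e_def sh per pb pc ..
  have pf: "f (i + 7) = f i" for i unfolding f_def sh pc pd pe ..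
  have pg: "g (i + 7) = g i" for i unfolding g_def sh pb pc pe ..
  have pk: "k (i + 7) = k i" for i unfolding k_def sh pc pd pg ..
  show ?thesis
    by (rule that[OF pb pc pd pe pf pg pk T1s T2 T3 FF KK])
qed

end

section \<open>A concrete model of the Klein graph\<close>

text \<open>The vertices of the Klein graph are arranged in eight classes \<open>a, b, c, d, e, f, g, k\<close>, each indexed
  by \<open>\<int>/7\<close>; the \<open>i\<close>-th vertex of class number \<open>l\<close> is encoded as \<open>7 * l + i\<close>. The neighbours of a vertex
  are listed in their cyclic order on the oriented surface.\<close>

definition klein_nbrs :: "nat list list" where
  "klein_nbrs = concat (map (\<lambda>h. map h [0..<7])
     [\<lambda>i. [(i + 6) mod 7, (i + 1) mod 7, 7 + i],
      \<lambda>i. [i, 21 + i, 14 + i],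
      \<lambda>i. [28 + (i + 6) mod 7, 7 + i, 42 + i],
      \<lambda>i. [7 + i, 28 + i, 42 + (i + 5) mod 7],
      \<lambda>i. [21 + i, 14 + (i + 1) mod 7, 35 + i],
      \<lambda>i. [35 + (i + 4) mod 7, 28 + i, 35 + (i + 3) mod 7],
      \<lambda>i. [14 + i, 49 + i, 21 + (i + 2) mod 7],
      \<lambda>i. [42 + i, 49 + (i + 5) mod 7, 49 + (i + 2) mod 7]])"

text \<open>Each list follows the cyclic orders of \<open>klein_nbrs\<close>, so two faces at an
  edge traverse it in opposite directions. The factors 4 and 2 are the steps -3 and 2, modulo 7, of
  the heptagons on \<open>f\<close> and \<open>k\<close>.\<close>

definition klein_faces :: "nat list list" where
  "klein_faces =
     map (\<lambda>j. j) [0..<7] # map (\<lambda>j. 35 + 4 * j mod 7) [0..<7] # map (\<lambda>j. 49 + 2 * j mod 7) [0..<7] #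
     concat (map (\<lambda>i.
       [[i, 7 + i, 21 + i, 28 + i, 14 + (i + 1) mod 7, 7 + (i + 1) mod 7, (i + 1) mod 7],
        [49 + (i + 5) mod 7, 42 + (i + 5) mod 7, 21 + i, 7 + i, 14 + i, 42 + i, 49 + i],
        [35 + i, 28 + i, 21 + i, 42 + (i + 5) mod 7, 14 + (i + 5) mod 7, 28 + (i + 4) mod 7,
         35 + (i + 4) mod 7]]) [0..<7])"

abbreviation nb :: "nat \<Rightarrow> nat list" where
  "nb v \<equiv> klein_nbrs ! v"

definition klein_graph :: "nat pair_pre_digraph" where
  "klein_graph = \<lparr> pverts = {..<56}, parcs = {(u, v). v < 56 \<and> u \<in> set (nb v)} \<rparr>"

text \<open>The rotation at \<open>v\<close>: the successor of \<open>u\<close> in the cyclic order.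
  Applied once or twice it gives the two continuations of a walk that arrives from
  \<open>u\<close>.\<close>

definition turn :: "nat \<Rightarrow> nat \<Rightarrow> nat" where
  "turn u v = (case nb v of [x, y, z] \<Rightarrow> if u = x then y else if u = y then z else x)"

text \<open>A Petrie walk in terms of the rotation: it turns to alternating sides, and the flag is
  the side of the next turn.\<close>

fun zigzag :: "nat \<Rightarrow> bool \<Rightarrow> nat \<Rightarrow> nat \<Rightarrow> nat" where
  "zigzag 0 b u v = u"
| "zigzag (Suc n) b u v = zigzag n (\<not> b) v (if b then turn u v else turn (turn u v) v)"

section \<open>Finite checks on the model\<close>

lemma upt7: "[0..<7] = [0, Suc 0, 2, 3, 4, 5, 6]"
  by (simp add: upt_conv_Cons numeral_2_eq_2 [symmetric])

lemma klein_nbrs_eq: "klein_nbrs =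
    [[6, Suc 0, 7], [0, 2, 8], [Suc 0, 3, 9], [2, 4, 10], [3, 5, 11], [4, 6, 12], [5, 0, 13],
     [0, 21, 14], [Suc 0, 22, 15], [2, 23, 16], [3, 24, 17], [4, 25, 18], [5, 26, 19], [6, 27, 20],
     [34, 7, 42], [28, 8, 43], [29, 9, 44], [30, 10, 45], [31, 11, 46], [32, 12, 47], [33, 13, 48],
     [7, 28, 47], [8, 29, 48], [9, 30, 42], [10, 31, 43], [11, 32, 44], [12, 33, 45], [13, 34, 46],
     [21, 15, 35], [22, 16, 36], [23, 17, 37], [24, 18, 38], [25, 19, 39], [26, 20, 40], [27, 14, 41],
     [39, 28, 38], [40, 29, 39], [41, 30, 40], [35, 31, 41], [36, 32, 35], [37, 33, 36], [38, 34, 37],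
     [14, 49, 23], [15, 50, 24], [16, 51, 25], [17, 52, 26], [18, 53, 27], [19, 54, 21], [20, 55, 22],
     [42, 54, 51], [43, 55, 52], [44, 49, 53], [45, 50, 54], [46, 51, 55], [47, 52, 49], [48, 53, 50]]"
  by (simp add: klein_nbrs_def upt7)

lemma nb_simps:
  "nb 0 = [6, Suc 0, 7]" "nb (Suc 0) = [0, 2, 8]" "nb 2 = [Suc 0, 3, 9]"
  "nb 3 = [2, 4, 10]" "nb 4 = [3, 5, 11]" "nb 5 = [4, 6, 12]"
  "nb 6 = [5, 0, 13]" "nb 7 = [0, 21, 14]" "nb 8 = [Suc 0, 22, 15]"
  "nb 9 = [2, 23, 16]" "nb 10 = [3, 24, 17]" "nb 11 = [4, 25, 18]"
  "nb 12 = [5, 26, 19]" "nb 13 = [6, 27, 20]" "nb 14 = [34, 7, 42]"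
  "nb 15 = [28, 8, 43]" "nb 16 = [29, 9, 44]" "nb 17 = [30, 10, 45]"
  "nb 18 = [31, 11, 46]" "nb 19 = [32, 12, 47]" "nb 20 = [33, 13, 48]"
  "nb 21 = [7, 28, 47]" "nb 22 = [8, 29, 48]" "nb 23 = [9, 30, 42]"
  "nb 24 = [10, 31, 43]" "nb 25 = [11, 32, 44]" "nb 26 = [12, 33, 45]"
  "nb 27 = [13, 34, 46]" "nb 28 = [21, 15, 35]" "nb 29 = [22, 16, 36]"
  "nb 30 = [23, 17, 37]" "nb 31 = [24, 18, 38]" "nb 32 = [25, 19, 39]"
  "nb 33 = [26, 20, 40]" "nb 34 = [27, 14, 41]" "nb 35 = [39, 28, 38]"
  "nb 36 = [40, 29, 39]" "nb 37 = [41, 30, 40]" "nb 38 = [35, 31, 41]"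
  "nb 39 = [36, 32, 35]" "nb 40 = [37, 33, 36]" "nb 41 = [38, 34, 37]"
  "nb 42 = [14, 49, 23]" "nb 43 = [15, 50, 24]" "nb 44 = [16, 51, 25]"
  "nb 45 = [17, 52, 26]" "nb 46 = [18, 53, 27]" "nb 47 = [19, 54, 21]"
  "nb 48 = [20, 55, 22]" "nb 49 = [42, 54, 51]" "nb 50 = [43, 55, 52]"
  "nb 51 = [44, 49, 53]" "nb 52 = [45, 50, 54]" "nb 53 = [46, 51, 55]"
  "nb 54 = [47, 52, 49]" "nb 55 = [48, 53, 50]"
  by (simp_all add: klein_nbrs_eq)

lemma klein_faces_eq: "klein_faces =
    [[0, Suc 0, 2, 3, 4, 5, 6], [35, 39, 36, 40, 37, 41, 38], [49, 51, 53, 55, 50, 52, 54],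
     [0, 7, 21, 28, 15, 8, Suc 0], [54, 47, 21, 7, 14, 42, 49], [35, 28, 21, 47, 19, 32, 39],
     [Suc 0, 8, 22, 29, 16, 9, 2], [55, 48, 22, 8, 15, 43, 50], [36, 29, 22, 48, 20, 33, 40],
     [2, 9, 23, 30, 17, 10, 3], [49, 42, 23, 9, 16, 44, 51], [37, 30, 23, 42, 14, 34, 41],
     [3, 10, 24, 31, 18, 11, 4], [50, 43, 24, 10, 17, 45, 52], [38, 31, 24, 43, 15, 28, 35],
     [4, 11, 25, 32, 19, 12, 5], [51, 44, 25, 11, 18, 46, 53], [39, 32, 25, 44, 16, 29, 36],
     [5, 12, 26, 33, 20, 13, 6], [52, 45, 26, 12, 19, 47, 54], [40, 33, 26, 45, 17, 30, 37],
     [6, 13, 27, 34, 14, 7, 0], [53, 46, 27, 13, 20, 48, 55], [41, 34, 27, 46, 18, 31, 38]]"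
  by (simp add: klein_faces_def upt7)

lemma upt56: "[0..<56] = [0, Suc 0, 2, 3, 4, 5, 6, 7, 8, 9, 10, 11, 12, 13,
    14, 15, 16, 17, 18, 19, 20, 21, 22, 23, 24, 25, 26, 27,
    28, 29, 30, 31, 32, 33, 34, 35, 36, 37, 38, 39, 40, 41,
    42, 43, 44, 45, 46, 47, 48, 49, 50, 51, 52, 53, 54, 55]"
  by (simp add: upt_conv_Cons numeral_2_eq_2 [symmetric])

text \<open>The last conjunct serves connectedness: stepping to a smaller neighbour ends at
  0.\<close>

lemma klein_nbrs_check: "list_all (\<lambda>v. case nb v of [x, y, z] \<Rightarrow>
      distinct [v, x, y, z] \<and> list_all (\<lambda>u. u < 56 \<and> v \<in> set (nb u)) [x, y, z] \<and>
      (v = 0 \<or> x < v \<or> y < v \<or> z < v)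
    | _ \<Rightarrow> False) [0..<56]"
  unfolding upt56 by (simp add: nb_simps)

lemma klein_faces_check: "list_all (\<lambda>xs. length xs = 7 \<and> distinct xs \<and>
    list_all (\<lambda>(u, v). v < 56 \<and> u \<in> set (nb v)) (zip xs (rotate1 xs))) klein_faces"
  unfolding klein_faces_eq upt56 by (simp add: nb_simps turn_def)

text \<open>Makes a face recoverable from its vertex set; looking at three vertices keeps the
  comparison of all pairs short.\<close>

lemma klein_faces_inj_check: "list_all (\<lambda>xs. list_all (\<lambda>ys.
    list_all (\<lambda>x. x \<in> set ys) (take 3 xs) \<longrightarrow> xs = ys) klein_faces) klein_faces"
  unfolding klein_faces_eq upt56 by simp

lemma klein_faces_at_vertex_check:
  "list_all (\<lambda>v. length (filter (\<lambda>xs. v \<in> set xs) klein_faces) = 3) [0..<56]"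
  unfolding klein_faces_eq upt56 by simp

lemma distinct_klein_faces: "distinct klein_faces"
  unfolding klein_faces_eq upt56 by simp

lemma klein_faces_turn_check: "list_all (\<lambda>xs.
     list_all (\<lambda>((u, v), w). turn u v = w) (zip (zip xs (rotate1 xs)) (rotate1 (rotate1 xs)))) klein_faces"
  unfolding klein_faces_eq by (simp add: nb_simps turn_def)

text \<open>As every arc lies on a listed face, this is the full table of \<open>turn\<close> on
  arcs.\<close>

lemmas turn_simps = klein_faces_turn_check[unfolded klein_faces_eq, simplified]

text \<open>Coherence of the orientation; by counting it will also show that every arc is
  used.\<close>

lemma distinct_klein_arcs: "distinct (concat (map (\<lambda>xs. zip xs (rotate1 xs)) klein_faces))"
  unfolding klein_faces_eq by simp

lemma zigzag_8: "zigzag 8 b u v = zigzag (Suc (Suc (Suc (Suc (Suc (Suc (Suc (Suc 0)))))))) b u v"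
  by (simp add: eval_nat_numeral)

lemma zigzag_check: "list_all (\<lambda>v. list_all (\<lambda>u.
    zigzag 8 True u v = u \<and> zigzag 8 False u v = u) (nb v)) [0..<56]"
  unfolding upt56 by (simp add: nb_simps turn_simps zigzag_8)

fun klein_paths :: "nat \<Rightarrow> nat list list" where
  "klein_paths 0 = [[0, 1, 2]]"
| "klein_paths (Suc n) = concat (map (\<lambda>xs. map (\<lambda>x. xs @ [x])
     (filter (\<lambda>x. \<not> x \<in> set xs) (nb (last xs)))) (klein_paths n))"

text \<open>The five path sets have three to seven vertices, so shorter cycles are ruled out
  together with other heptagons.\<close>

lemma klein_paths_check:
  "filter (\<lambda>xs. 0 \<in> set (nb (last xs)))
     (klein_paths 0 @ klein_paths (Suc 0) @ klein_paths (Suc (Suc 0)) @ klein_paths (Suc (Suc (Suc 0))) @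
      klein_paths (Suc (Suc (Suc (Suc 0))))) = [[0, 1, 2, 3, 4, 5, 6]]"
  by (simp add: nb_simps)

section \<open>Every labelling is an isomorphism\<close>

abbreviation karc :: "nat \<Rightarrow> nat \<Rightarrow> bool" where
  "karc u v \<equiv> (u, v) \<in> parcs klein_graph"

lemma karc_iff: "karc u v \<longleftrightarrow> v < 56 \<and> u \<in> set (nb v)"
  by (simp add: klein_graph_def)

lemma nb_cases:
  assumes "v < 56"
  obtains x y z where "nb v = [x, y, z]" "distinct [v, x, y, z]"
    "\<And>u. u \<in> {x, y, z} \<Longrightarrow> u < 56 \<and> v \<in> set (nb u)" "v = 0 \<or> x < v \<or> y < v \<or> z < v"
proof -
  from assms have "v \<in> set [0..<56]" by simp
  from bspec[OF klein_nbrs_check[unfolded list_all_iff] this]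
  obtain x y z where 1: "nb v = [x, y, z]" by (auto split: list.splits)
  show ?thesis
    by (rule that[OF 1])
      (use bspec[OF klein_nbrs_check[unfolded list_all_iff] \<open>v \<in> set [0..<56]\<close>] 1 in auto)
qed

lemma karc_sym: "karc u v \<Longrightarrow> karc v u"
  using nb_cases[of v] unfolding karc_iff by (metis list.set(1) list.set(2))

lemma karc_less: "karc u v \<Longrightarrow> u < 56 \<and> v < 56"
  using karc_sym karc_iff by metis

lemma karc_turn:
  assumes "karc u v"
  shows "karc v (turn u v)" "set (nb v) = {u, turn u v, turn (turn u v) v}"
    "distinct [u, turn u v, turn (turn u v) v]" "turn (turn (turn u v) v) v = u"
proof -
  have v: "v < 56" "u \<in> set (nb v)" using assms by (auto simp: karc_iff)
  obtain x y z where n: "nb v = [x, y, z]" "distinct [v, x, y, z]"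
    "\<And>u. u \<in> {x, y, z} \<Longrightarrow> u < 56 \<and> v \<in> set (nb u)"
    using nb_cases[OF v(1)] by metis
  have t: "turn x v = y" "turn y v = z" "turn z v = x" using n(1,2) by (auto simp: turn_def)
  have k: "karc v x" "karc v y" "karc v z" using n(3) v(1) by (auto simp: karc_iff)
  consider "u = x" | "u = y" | "u = z" using v n by auto
  then show "karc v (turn u v)" "set (nb v) = {u, turn u v, turn (turn u v) v}"
    "distinct [u, turn u v, turn (turn u v) v]" "turn (turn (turn u v) v) v = u"
    by (cases; use k n(1,2) in \<open>simp add: t; blast?\<close>)+
qed

lemma klein_faceD:
  assumes "xs \<in> set klein_faces"
  shows "length xs = 7" "cycle_in klein_graph xs" "set xs \<subseteq> {..<56}"
proof -
  note c = bspec[OF klein_faces_check[unfolded list_all_iff] assms]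
  show l: "length xs = 7" using c by simp
  show cy: "cycle_in klein_graph xs"
    using c by (auto simp: cycle_in_def cyc_def karc_iff)
  show "set xs \<subseteq> {..<56}"
  proof
    fix x assume "x \<in> set xs"
    then obtain y where "(x, y) \<in> parcs (cyc xs)" using in_set_imp_arc_cyc by metis
    then have "karc x y" using cy by (auto simp: cycle_in_def)
    then show "x \<in> {..<56}" using karc_less by auto
  qed
qed

lemma klein_face_turn:
  assumes "xs \<in> set klein_faces" "(u, v) \<in> parcs (cyc xs)"
  shows "(v, turn u v) \<in> parcs (cyc xs)"
proof -
  obtain a b c d e f g where x: "xs = [a, b, c, d, e, f, g]"
    using klein_faceD(1)[OF assms(1)] by (rule length7E)
  show ?thesis
    using assms(2) bspec[OF klein_faces_turn_check[unfolded list_all_iff] assms(1)]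
    unfolding x by (auto simp: parcs_cyc7)
qed

lemma card_parcs_klein_graph: "card (parcs klein_graph) = 168"
proof -
  have "parcs klein_graph = (\<lambda>(v, u). (u, v)) ` (SIGMA v:{..<56}. set (nb v))"
    by (auto simp: klein_graph_def)
  then have "card (parcs klein_graph) = card (SIGMA v:{..<56}. set (nb v))"
    by (simp add: card_image inj_on_def)
  also have "\<dots> = (\<Sum>v<56. card (set (nb v)))" by simp
  also have "\<dots> = (\<Sum>v::nat<56. 3)"
  proof (rule sum.cong)
    fix v :: nat assume "v \<in> {..<56}"
    then obtain x y z where "nb v = [x, y, z]" "distinct [v, x, y, z]"
      by (metis lessThan_iff nb_cases)
    then show "card (set (nb v)) = 3" by simp
  qed simp
  finally show ?thesis by simp
qed

text \<open>Counting replaces a search: 24 lists with 7 arcs each, all different, make 168, which is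
  the number of arcs.\<close>

lemma klein_face_ex1:
  assumes "karc u v"
  shows "\<exists>!xs. xs \<in> set klein_faces \<and> (u, v) \<in> parcs (cyc xs)"
proof -
  let ?A = "concat (map (\<lambda>xs. zip xs (rotate1 xs)) klein_faces)"
  have fin: "finite (parcs klein_graph)"
    using card_parcs_klein_graph by (metis card.infinite zero_neq_numeral)
  have len: "length ?A = 168"
  proof -
    have "length ?A = sum_list (map (\<lambda>xs. 7) klein_faces)"
      unfolding length_concat map_map comp_def
      by (rule arg_cong[where f = sum_list], rule map_cong) (use klein_faceD(1) in auto)
    also have "\<dots> = 168" unfolding klein_faces_eq by simp
    finally show ?thesis .
  qed
  have "set ?A \<subseteq> parcs klein_graph"
    using klein_faceD(2) by (auto simp: cycle_in_def cyc_def)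
  moreover have "card (set ?A) = 168" using distinct_card[OF distinct_klein_arcs] len by simp
  ultimately have "set ?A = parcs klein_graph"
    using card_parcs_klein_graph fin by (metis card_subset_eq)
  then have ex: "\<exists>xs. xs \<in> set klein_faces \<and> (u, v) \<in> parcs (cyc xs)"
    using assms by (auto simp: cyc_def)
  have uniq: "xs = ys" if m: "xs \<in> set klein_faces" "ys \<in> set klein_faces"
    "(u, v) \<in> parcs (cyc xs)" "(u, v) \<in> parcs (cyc ys)" for xs ys
  proof (rule ccontr)
    assume "xs \<noteq> ys"
    have "zip xs (rotate1 xs) \<noteq> zip ys (rotate1 ys)"
      using \<open>xs \<noteq> ys\<close> by (metis length_rotate1 map_fst_zip)
    then have "set (zip xs (rotate1 xs)) \<inter> set (zip ys (rotate1 ys)) = {}"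
      using distinct_klein_arcs m(1,2) unfolding distinct_concat_iff by auto
    then show False using m(3,4) by (auto simp: cyc_def)
  qed
  show ?thesis
  proof (rule ex_ex1I[OF ex])
    fix xs ys
    assume "xs \<in> set klein_faces \<and> (u, v) \<in> parcs (cyc xs)"
      and "ys \<in> set klein_faces \<and> (u, v) \<in> parcs (cyc ys)"
    then show "xs = ys" using uniq[of xs ys] by metis
  qed
qed

text \<open>A corner turns along the rotation at \<open>v\<close> or against it; in the second case
  the reversed path \<open>w, v, u\<close> turns along it.\<close>

lemma klein_corner_face:
  assumes "karc u v" "karc v w" "u \<noteq> w"
  shows "\<exists>xs\<in>set klein_faces. (u, v) \<in> parcs (scyc xs) \<and> (v, w) \<in> parcs (scyc xs)"
proof -
  have "w \<in> set (nb v)" using karc_sym[OF assms(2)] by (simp add: karc_iff)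
  then consider "w = turn u v" | "w = turn (turn u v) v" using karc_turn(2)[OF assms(1)] assms(3) by auto
  then show ?thesis
  proof cases
    case 1
    obtain xs where "xs \<in> set klein_faces" "(u, v) \<in> parcs (cyc xs)" using klein_face_ex1[OF assms(1)] by auto
    then show ?thesis
      using klein_face_turn[of xs u v] 1 by (auto simp: parcs_mk_symmetric_with_proj)
  next
    case 2
    then have u: "u = turn w v" using karc_turn(4)[OF assms(1)] by simp
    obtain xs where "xs \<in> set klein_faces" "(w, v) \<in> parcs (cyc xs)"
      using klein_face_ex1[OF karc_sym[OF assms(2)]] by auto
    then show ?thesis
      using klein_face_turn[of xs w v] u by (auto simp: parcs_mk_symmetric_with_proj)
  qed
qed

text \<open>Exactly the indices outside \<open>0, ..., 6\<close> that occur in the instances of the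
  face families used for the labelling.\<close>

lemma periodic7:
  fixes h :: "int \<Rightarrow> 'a"
  assumes "\<And>i. h (i + 7) = h i"
  shows "h (-1) = h 6" "h (-2) = h 5" "h (-3) = h 4" "h (-6) = h 1" "h (-9) = h 5" "h (-12) = h 2"
    "h (-15) = h 6" "h (-18) = h 3" "h 7 = h 0" "h 8 = h 1" "h 10 = h 3" "h 12 = h 5"
  using assms[of "-1"] assms[of "-2"] assms[of "-3"] assms[of "-6"] assms[of "-9"] assms[of "-2"]
    assms[of "-12"] assms[of "-5"] assms[of "-15"] assms[of "-8"] assms[of "-1"]
    assms[of "-18"] assms[of "-11"] assms[of "-4"] assms[of 0] assms[of 1] assms[of 3] assms[of 5]
  by simp_all

context klein_rules begin

lemma labelling:
  assumes "corner x y z"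
  obtains \<psi> :: "nat \<Rightarrow> 'a" where "\<psi> 0 = x" "\<psi> 1 = y" "\<psi> 2 = z"
    "\<And>xs. xs \<in> set klein_faces \<Longrightarrow> face (map \<psi> xs)"
proof -
  obtain p q r s where f0: "face [x, y, z, p, q, r, s]" using face_ex[OF assms] by blast
  note f1 = face_rotate[OF f0]
  note f2 = face_rotate[OF f1]
  note f3 = face_rotate[OF f2]
  note f4 = face_rotate[OF f3]
  note f5 = face_rotate[OF f4]
  note f6 = face_rotate[OF f5]
  define a where "a = (\<lambda>i :: int. [x, y, z, p, q, r, s] ! nat (i mod 7))"
  have a: "a 0 = x" "a 1 = y" "a 2 = z" "a 3 = p" "a 4 = q" "a 5 = r" "a 6 = s"
    by (simp_all add: a_def)
  have per: "a (i + 7) = a i" for i by (simp add: a_def)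
  \<comment> \<open>Reduces the claim about all integers to seven instances, which are the rotations
    \<open>f0, ..., f6\<close> of the face.\<close>
  have am: "a (i + j) = a (i mod 7 + j)" for i j by (simp add: a_def mod_simps)
  have "fc (a (i mod 7 + 0)) (a (i mod 7 + 1)) (a (i mod 7 + 2)) (a (i mod 7 + 3))" for i
  proof -
    have "i mod 7 \<in> {0..<7}" by simp
    moreover have "{0..<7} = {0, 1, 2, 3, 4, 5, 6 :: int}" by auto
    ultimately have "i mod 7 \<in> {0, 1, 2, 3, 4, 5, 6}" by metis
    then show ?thesis
      using f0[THEN face_fc] f1[THEN face_fc] f2[THEN face_fc] f3[THEN face_fc] f4[THEN face_fc]
        f5[THEN face_fc] f6[THEN face_fc] per[of 0] per[of 1] per[of 2]
      by (auto simp: a)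
  qed
  then have A: "fc (a i) (a (i + 1)) (a (i + 2)) (a (i + 3))" for i
    using am[of i 0] am[of i 1] am[of i 2] am[of i 3] by simp
  obtain b c d e f g k :: "int \<Rightarrow> 'a" where
    P: "\<And>i. b (i + 7) = b i" "\<And>i. c (i + 7) = c i" "\<And>i. d (i + 7) = d i" "\<And>i. e (i + 7) = e i"
      "\<And>i. f (i + 7) = f i" "\<And>i. g (i + 7) = g i" "\<And>i. k (i + 7) = k i" and
    T1: "\<And>i. face [a i, b i, d i, e i, c (i + 1), b (i + 1), a (i + 1)]" and
    T2: "\<And>i. face [k (i - 2), g (i - 2), d i, b i, c i, g i, k i]" and
    T3: "\<And>i. face [f i, e i, d i, g (i - 2), c (i - 2), e (i - 3), f (i - 3)]" and
    TF: "\<And>i. face [f i, f (i - 3), f (i - 6), f (i - 9), f (i - 12), f (i - 15), f (i - 18)]" and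
    TK: "\<And>i. face [k i, k (i - 2), k (i - 4), k (i - 6), k (i - 8), k (i - 10), k (i - 12)]"
    using labelling_families[OF A per] by blast
  note per7 = periodic7[of a, OF per] periodic7[of b, OF P(1)] periodic7[of c, OF P(2)]
    periodic7[of d, OF P(3)] periodic7[of e, OF P(4)] periodic7[of f, OF P(5)]
    periodic7[of g, OF P(6)] periodic7[of k, OF P(7)]
  define \<psi> where "\<psi> = (\<lambda>n :: nat. ([a, b, c, d, e, f, g, k] ! (n div 7)) (int (n mod 7)))"
  have "face [x, y, z, p, q, r, s]" by (rule f0)
  moreover have "face [f 0, f 4, f 1, f 5, f 2, f 6, f 3]" using TF[of 0] by (simp add: per7)
  \<comment> \<open>The family descends in steps of 2 and the model ascends; starting at 12 makes
    the reversed list begin with \<open>k 0\<close>.\<close>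
  moreover have "face [k 0, k 2, k 4, k 6, k 1, k 3, k 5]" using face_rev[OF TK[of 12]] by (simp add: per7)
  ultimately have "list_all (\<lambda>xs. face (map \<psi> xs)) klein_faces"
    unfolding klein_faces_eq \<psi>_def
    using T1[of 0] T1[of 1] T1[of 2] T1[of 3] T1[of 4] T1[of 5] T1[of 6]
      T2[of 0] T2[of 1] T2[of 2] T2[of 3] T2[of 4] T2[of 5] T2[of 6]
      T3[of 0] T3[of 1] T3[of 2] T3[of 3] T3[of 4] T3[of 5] T3[of 6]
    by (simp add: per7 a)
  then have "face (map \<psi> xs)" if "xs \<in> set klein_faces" for xs using that by (simp add: list_all_iff)
  moreover have "\<psi> 0 = x" "\<psi> 1 = y" "\<psi> 2 = z" by (simp_all add: \<psi>_def a)
  ultimately show ?thesis using that by blast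
qed

end

locale klein_map_rules = klein_rules +
  assumes conn: "Digraph_Component.connected (with_proj G)" and card56: "card (pverts G) = 56"
begin

lemma adj_closed_imp_verts:
  assumes "u \<in> S" "u \<in> pverts G" "\<And>v w. v \<in> S \<Longrightarrow> adj v w \<Longrightarrow> w \<in> S"
  shows "pverts G \<subseteq> S"
proof
  fix v assume "v \<in> pverts G"
  then have "(u, v) \<in> rtrancl_on (pverts G) (parcs G \<union> (parcs G)\<inverse>)"
    using conn assms(2)
    by (auto simp: connected_def strongly_connected_def reachable_def parcs_mk_symmetric_with_proj)
  moreover have "parcs G \<union> (parcs G)\<inverse> = parcs G" using adj_sym by auto
  ultimately have "(u, v) \<in> (parcs G)\<^sup>*" using rtrancl_on_rtranclI by metis
  then show "v \<in> S" by (induction rule: rtrancl_induct) (use assms in auto)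
qed

section \<open>A labelling is a covering, hence an isomorphism\<close>

context
  fixes \<psi> :: "nat \<Rightarrow> 'a"
  assumes faces: "\<And>xs. xs \<in> set klein_faces \<Longrightarrow> face (map \<psi> xs)"
begin

lemma label_parcs_cyc:
  "(u, v) \<in> parcs (cyc xs) \<Longrightarrow> (\<psi> u, \<psi> v) \<in> parcs (cyc (map \<psi> xs))"
  using map_graph_cyc[of \<psi> xs, symmetric] by (force simp: map_graph_def)

lemma label_adj: "karc u v \<Longrightarrow> adj (\<psi> u) (\<psi> v)"
  using klein_face_ex1[of u v] faces label_parcs_cyc by (fastforce simp: face_def cycle_in_def)

text \<open>Local injectivity: two neighbours of a vertex lie on a common face, whose seven labels
  are distinct.\<close>

lemma label_corner_neq:
  assumes "karc u v" "karc v w" "u \<noteq> w"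
  shows "\<psi> u \<noteq> \<psi> w"
proof -
  obtain xs where xs: "xs \<in> set klein_faces" "(u, v) \<in> parcs (scyc xs)" "(v, w) \<in> parcs (scyc xs)"
    using klein_corner_face[OF assms] by blast
  then have "u \<in> set xs" "w \<in> set xs"
    by (auto simp: parcs_mk_symmetric_with_proj cyc_def dest: set_zip_leftD set_zip_rightD)
  moreover have "distinct (map \<psi> xs)" using faces[OF xs(1)] by (simp add: face_def cycle_in_def)
  ultimately show ?thesis using assms(3) by (auto simp: distinct_map inj_on_def)
qed

text \<open>Local surjectivity: the labels of the three neighbours are distinct, so they exhaust the
  neighbours of a cubic vertex.\<close>

lemma label_adjD:
  assumes "v < 56" "adj (\<psi> v) s"
  obtains u where "karc v u" "s = \<psi> u"
proof -
  obtain x y z where n: "nb v = [x, y, z]" "distinct [v, x, y, z]"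
    using nb_cases[OF assms(1)] by metis
  have k: "karc x v" "karc y v" "karc z v" using n(1) assms(1) by (auto simp: karc_iff)
  note k' = k[THEN karc_sym]
  have "s = \<psi> x \<or> s = \<psi> y \<or> s = \<psi> z"
    using k'[THEN label_adj] assms(2) label_corner_neq[OF k(1) k'(2)] label_corner_neq[OF k(1) k'(3)]
      label_corner_neq[OF k(2) k'(3)] n(2)
    by (intro nbr_cases[of "\<psi> v"]) auto
  then show ?thesis using k' that by blast
qed

lemma label_image: "\<psi> ` {..<56} = pverts G"
proof
  have v: "\<psi> v \<in> pverts G" if v: "v < 56" for v
  proof -
    obtain x y z where "nb v = [x, y, z]" using nb_cases[OF v] by metis
    then have "karc x v" using v by (simp add: karc_iff)
    then show ?thesis using label_adj adj_verts by blast
  qed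
  then show "\<psi> ` {..<56} \<subseteq> pverts G" by auto
  show "pverts G \<subseteq> \<psi> ` {..<56}"
  proof (rule adj_closed_imp_verts[of "\<psi> 0"])
    show "\<psi> 0 \<in> \<psi> ` {..<56}" by simp
    show "\<psi> 0 \<in> pverts G" using v by simp
    fix s t assume "s \<in> \<psi> ` {..<56}" "adj s t"
    then obtain v where v: "v < 56" "s = \<psi> v" by auto
    then obtain u where "karc v u" "t = \<psi> u" using \<open>adj s t\<close> label_adjD by metis
    then show "t \<in> \<psi> ` {..<56}" using karc_less by blast
  qed
qed

lemma label_inj: "inj_on \<psi> {..<56}"
  by (rule eq_card_imp_inj_on) (simp_all add: label_image card56)

lemma label_adj_iff:
  assumes "u < 56" "v < 56"
  shows "adj (\<psi> u) (\<psi> v) \<longleftrightarrow> karc u v"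
proof
  assume "adj (\<psi> u) (\<psi> v)"
  then obtain w where w: "karc u w" "\<psi> v = \<psi> w" using label_adjD assms by metis
  then have "v = w" using label_inj assms karc_less by (auto dest: inj_onD)
  then show "karc u v" using w by simp
qed (rule label_adj)

lemma label_iso: "graph_iso \<psi> klein_graph G"
proof -
  have "parcs G = map_prod \<psi> \<psi> ` parcs klein_graph"
  proof (intro equalityI)
    show "map_prod \<psi> \<psi> ` parcs klein_graph \<subseteq> parcs G" using label_adj by auto
    show "parcs G \<subseteq> map_prod \<psi> \<psi> ` parcs klein_graph"
    proof
      fix a assume "a \<in> parcs G"
      then obtain s t where st: "a = (s, t)" "adj s t" by (cases a) auto
      then have "s \<in> \<psi> ` {..<56}" "t \<in> \<psi> ` {..<56}" using adj_verts[OF st(2)] by (simp_all add: label_image)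
      then obtain u v where uv: "s = \<psi> u" "t = \<psi> v" "u < 56" "v < 56" by auto
      then have "karc u v" using st(2) label_adj_iff[of u v] by simp
      then have "map_prod \<psi> \<psi> (u, v) \<in> map_prod \<psi> \<psi> ` parcs klein_graph" by (rule imageI)
      then show "a \<in> map_prod \<psi> \<psi> ` parcs klein_graph" by (simp add: st(1) uv)
    qed
  qed
  moreover have "pverts klein_graph = {..<56}" by (simp add: klein_graph_def)
  ultimately show ?thesis
    using label_inj label_image by (simp add: graph_iso_def map_graph_def)
qed

text \<open>A face is the only one at each of its corners, so it coincides with the image of the
  model face at the pulled-back corner.\<close>

lemma label_faces: "F = (\<lambda>xs. scyc (map \<psi> xs)) ` set klein_faces"
proof
  show "(\<lambda>xs. scyc (map \<psi> xs)) ` set klein_faces \<subseteq> F" using faces by (auto simp: face_def)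
  show "F \<subseteq> (\<lambda>xs. scyc (map \<psi> xs)) ` set klein_faces"
  proof
    fix f assume f: "f \<in> F"
    then obtain xs where xs: "length xs = 7" "f = scyc xs" "cycle_in G xs"
      using heptagons copies_cycle_graph[OF pair_sym_digraph, of 7] by auto
    obtain x0 x1 x2 x3 x4 x5 x6 where x: "xs = [x0, x1, x2, x3, x4, x5, x6]"
      using xs(1) by (rule length7E)
    have c: "corner x0 x1 x2" using xs(3) unfolding x by (auto simp: cycle_in_def parcs_cyc7)
    have "x0 \<in> \<psi> ` {..<56}" "x1 \<in> \<psi> ` {..<56}" "x2 \<in> \<psi> ` {..<56}"
      using c adj_verts[of x0 x1] adj_verts[of x1 x2] by (simp_all add: label_image)
    then obtain u v w where uvw: "x0 = \<psi> u" "x1 = \<psi> v" "x2 = \<psi> w" "u < 56" "v < 56" "w < 56"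
      by auto
    then have k: "karc u v" "karc v w" "u \<noteq> w"
      using c label_adj_iff[of u v] label_adj_iff[of v w] by auto
    obtain ys where ys: "ys \<in> set klein_faces" "(u, v) \<in> parcs (scyc ys)" "(v, w) \<in> parcs (scyc ys)"
      using klein_corner_face[OF k] by blast
    have "(x0, x1) \<in> parcs (scyc (map \<psi> ys))" "(x1, x2) \<in> parcs (scyc (map \<psi> ys))"
      using ys(2,3) label_parcs_cyc uvw by (auto simp: parcs_mk_symmetric_with_proj)
    moreover have "(x0, x1) \<in> parcs f" "(x1, x2) \<in> parcs f"
      unfolding xs(2) x parcs_scyc7 by simp_all
    moreover have "scyc (map \<psi> ys) \<in> F" using faces[OF ys(1)] by (simp add: face_def)
    ultimately have "f = scyc (map \<psi> ys)" using corner_face_ex1[OF c] f by metis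
    then show "f \<in> (\<lambda>xs. scyc (map \<psi> xs)) ` set klein_faces" using ys(1) by blast
  qed
qed

end

end

section \<open>Cycles and automorphisms\<close>

lemma klein_paths_complete:
  assumes "length xs = n + 3" "distinct xs" "take 3 xs = [0, 1, 2]"
    "\<And>i. Suc i < length xs \<Longrightarrow> karc (xs ! i) (xs ! Suc i)"
  shows "xs \<in> set (klein_paths n)"
  using assms
proof (induction n arbitrary: xs)
  case 0
  then have "xs = [0, 1, 2]" by simp
  then show ?case by simp
next
  case (Suc n)
  obtain ys x where xs: "xs = ys @ [x]" using Suc.prems(1) by (cases xs rule: rev_cases) auto
  have "ys \<in> set (klein_paths n)"
  proof (rule Suc.IH)
    show "karc (ys ! i) (ys ! Suc i)" if "Suc i < length ys" for i
      using Suc.prems(4)[of i] that by (simp add: xs nth_append)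
  qed (use Suc.prems xs in auto)
  moreover have "x \<notin> set ys" using Suc.prems(2) xs by simp
  moreover have "x \<in> set (nb (last ys))"
  proof -
    have "ys \<noteq> []" using Suc.prems(1) xs by auto
    then have "karc (last ys) x"
      using Suc.prems(4)[of "length ys - 1"] by (simp add: xs nth_append last_conv_nth)
    then show ?thesis using karc_sym[of "last ys" x] by (simp add: karc_iff)
  qed
  ultimately show ?case unfolding xs by auto
qed

lemma cycle_in_nth:
  assumes "cycle_in G xs" "Suc i < length xs"
  shows "(xs ! i, xs ! Suc i) \<in> parcs G"
proof -
  have "(xs ! i, rotate1 xs ! i) \<in> parcs (cyc xs)" using assms(2) by (auto simp: cyc_def set_zip)
  then show ?thesis using assms by (auto simp: cycle_in_def nth_rotate1)
qed

lemma cycle_in_last: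
  assumes "cycle_in G (x # xs)"
  shows "(last (x # xs), x) \<in> parcs G"
proof -
  have "((x # xs) ! length xs, rotate1 (x # xs) ! length xs) \<in> parcs (cyc (x # xs))"
    by (auto simp: cyc_def set_zip simp del: rotate1.simps)
  moreover have "(x # xs) ! length xs = last (x # xs)"
    using last_conv_nth[of "x # xs"] by (simp del: last.simps)
  moreover have "rotate1 (x # xs) ! length xs = x" by simp
  ultimately show ?thesis using assms by (auto simp: cycle_in_def simp del: last.simps)
qed

lemma klein_cycle:
  assumes "cycle_in klein_graph (0 # 1 # 2 # ys)" "length ys \<le> 4"
  shows "ys = [3, 4, 5, 6]"
proof -
  let ?xs = "0 # 1 # 2 # ys"
  have p: "?xs \<in> set (klein_paths (length ys))"
    using assms(1) cycle_in_nth[OF assms(1)]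
    by (intro klein_paths_complete) (auto simp: cycle_in_def numeral_3_eq_3)
  have "length ys = 0 \<or> length ys = Suc 0 \<or> length ys = Suc (Suc 0) \<or> length ys = Suc (Suc (Suc 0))
     \<or> length ys = Suc (Suc (Suc (Suc 0)))" using assms(2) by linarith
  moreover have "0 \<in> set (nb (last ?xs))"
    using karc_sym[OF cycle_in_last[OF assms(1)]] by (simp add: karc_iff)
  ultimately have "?xs \<in> set (filter (\<lambda>xs. 0 \<in> set (nb (last xs)))
     (klein_paths 0 @ klein_paths (Suc 0) @ klein_paths (Suc (Suc 0)) @ klein_paths (Suc (Suc (Suc 0))) @
      klein_paths (Suc (Suc (Suc (Suc 0))))))"
    using p unfolding set_filter set_append by auto
  then show ?thesis unfolding klein_paths_check by simp
qed

lemma graph_iso_comp: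
  assumes "graph_iso f G H" "graph_iso g H K"
  shows "graph_iso (g \<circ> f) G K"
proof -
  have "f ` pverts G = pverts H" using assms(1) by (auto simp: graph_iso_def map_graph_def)
  then show ?thesis
    using assms by (auto simp: graph_iso_def map_graph_comp[symmetric] intro: comp_inj_on)
qed

lemma graph_iso_inv:
  assumes "graph_iso f G H" "pair_wf_digraph G"
  shows "graph_iso (inv_into (pverts G) f) H G"
proof -
  let ?g = "inv_into (pverts G) f"
  have f: "inj_on f (pverts G)" "map_graph f G = H" using assms(1) by (auto simp: graph_iso_def)
  have H: "pverts H = f ` pverts G" using f(2) by (auto simp: map_graph_def)
  have "map_graph ?g H = map_graph (?g \<circ> f) G" by (simp add: f(2)[symmetric] map_graph_comp)
  also have "\<dots> = map_graph id G"
    by (rule map_graph_cong) (use f(1) assms(2) in auto)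
  also have "\<dots> = G" by (simp add: map_graph_def map_prod_ident id_def)
  finally show ?thesis using H by (simp add: graph_iso_def inj_on_inv_into)
qed

lemma cycle_in_rotate7:
  "cycle_in G [a, b, c, d, e, f, g] \<Longrightarrow> cycle_in G [b, c, d, e, f, g, a]"
  by (auto simp: cycle_in_def parcs_cyc7)

text \<open>The oriented counterpart of \<open>face_through_arc\<close>; only the seven rotations
  are available, as a reversal changes the cycle.\<close>

lemma cycle_through_arc:
  assumes "cycle_in G xs" "length xs = 7" "(u, v) \<in> parcs (cyc xs)"
  shows "\<exists>c d e p q. cycle_in G [u, v, c, d, e, p, q] \<and> cyc xs = cyc [u, v, c, d, e, p, q]"
proof -
  obtain x0 x1 x2 x3 x4 x5 x6 where x: "xs = [x0, x1, x2, x3, x4, x5, x6]"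
    using assms(2) by (rule length7E)
  have r0: "cycle_in G [x0, x1, x2, x3, x4, x5, x6]" "cyc xs = cyc [x0, x1, x2, x3, x4, x5, x6]"
    using assms(1) x by simp_all
  note r1 = cycle_in_rotate7[OF r0(1)] trans[OF r0(2) cyc7_rotate]
  note r2 = cycle_in_rotate7[OF r1(1)] trans[OF r1(2) cyc7_rotate]
  note r3 = cycle_in_rotate7[OF r2(1)] trans[OF r2(2) cyc7_rotate]
  note r4 = cycle_in_rotate7[OF r3(1)] trans[OF r3(2) cyc7_rotate]
  note r5 = cycle_in_rotate7[OF r4(1)] trans[OF r4(2) cyc7_rotate]
  note r6 = cycle_in_rotate7[OF r5(1)] trans[OF r5(2) cyc7_rotate]
  have "(u, v) \<in> {(x0, x1), (x1, x2), (x2, x3), (x3, x4), (x4, x5), (x5, x6), (x6, x0)}"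
    using assms(3) unfolding x parcs_cyc7 .
  then consider "u = x0" "v = x1" | "u = x1" "v = x2" | "u = x2" "v = x3" | "u = x3" "v = x4"
    | "u = x4" "v = x5" | "u = x5" "v = x6" | "u = x6" "v = x0" by auto
  then show ?thesis
  proof cases
    case 1 with r0 show ?thesis by metis
  next
    case 2 with r1 show ?thesis by metis
  next
    case 3 with r2 show ?thesis by metis
  next
    case 4 with r3 show ?thesis by metis
  next
    case 5 with r4 show ?thesis by metis
  next
    case 6 with r5 show ?thesis by metis
  next
    case 7 with r6 show ?thesis by metis
  qed
qed

lemma klein_graph_wf: "pair_wf_digraph klein_graph"
proof
  fix a assume a: "a \<in> parcs klein_graph"
  then have "fst a < 56 \<and> snd a < 56" using karc_less[of "fst a" "snd a"] by simp
  then show "fst a \<in> pverts klein_graph" "snd a \<in> pverts klein_graph"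
    by (simp_all add: klein_graph_def)
qed

section \<open>Short cycles and automorphisms through labellings\<close>

context klein_map_rules begin

definition labels :: "(nat \<Rightarrow> 'a) \<Rightarrow> bool" where
  "labels \<psi> \<longleftrightarrow> (\<forall>xs\<in>set klein_faces. face (map \<psi> xs))"

lemma ex_labels:
  assumes "corner x y z"
  obtains \<psi> where "labels \<psi>" "\<psi> 0 = x" "\<psi> 1 = y" "\<psi> 2 = z"
  using labelling[OF assms] unfolding labels_def by metis

lemma labelsD:
  assumes "labels \<psi>"
  shows "\<And>xs. xs \<in> set klein_faces \<Longrightarrow> face (map \<psi> xs)" "inj_on \<psi> {..<56}" "\<psi> ` {..<56} = pverts G"
    "\<And>u v. u < 56 \<Longrightarrow> v < 56 \<Longrightarrow> adj (\<psi> u) (\<psi> v) \<longleftrightarrow> karc u v"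
    "graph_iso \<psi> klein_graph G" "F = (\<lambda>xs. scyc (map \<psi> xs)) ` set klein_faces"
proof -
  show 1: "\<And>xs. xs \<in> set klein_faces \<Longrightarrow> face (map \<psi> xs)" using assms by (simp add: labels_def)
  show "inj_on \<psi> {..<56}" "\<psi> ` {..<56} = pverts G"
    "\<And>u v. u < 56 \<Longrightarrow> v < 56 \<Longrightarrow> adj (\<psi> u) (\<psi> v) \<longleftrightarrow> karc u v"
    "graph_iso \<psi> klein_graph G" "F = (\<lambda>xs. scyc (map \<psi> xs)) ` set klein_faces"
    by (intro label_inj label_image label_adj_iff label_iso label_faces 1; assumption)+
qed

text \<open>A labelling that starts at the first three vertices turns the cycle into one of the
  model through \<open>0, 1, 2\<close>, where the enumeration leaves only a face. The girth and the
  equality of \<open>F\<close> with the set of all 7-cycles both rest on this.\<close>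

lemma cycle_face:
  assumes "cycle_in G xs" "3 \<le> length xs" "length xs \<le> 7"
  shows "face xs"
proof -
  obtain x y z ys where xs: "xs = x # y # z # ys"
    using assms(2) by (metis (no_types) Suc_le_length_iff numeral_3_eq_3)
  have c: "corner x y z"
    using cycle_in_nth[OF assms(1), of 0] cycle_in_nth[OF assms(1), of 1] assms(1)
    by (auto simp: xs cycle_in_def)
  obtain \<psi> where \<psi>: "labels \<psi>" "\<psi> 0 = x" "\<psi> 1 = y" "\<psi> 2 = z" using ex_labels[OF c] by metis
  note L = labelsD[OF \<psi>(1)]
  have sub: "set xs \<subseteq> \<psi> ` {..<56}"
  proof
    fix s assume "s \<in> set xs"
    then obtain t where "(s, t) \<in> parcs (cyc xs)" using in_set_imp_arc_cyc by metis
    then have "adj s t" using assms(1) by (auto simp: cycle_in_def)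
    then show "s \<in> \<psi> ` {..<56}" using adj_verts by (simp add: L(3))
  qed
  define h where "h = inv_into {..<56} \<psi>"
  have h: "h (\<psi> n) = n" if "n < 56" for n using L(2) that by (simp add: h_def)
  have \<psi>h: "\<psi> (h s) = s" "h s < 56" if "s \<in> set xs" for s
    using sub that by (auto simp: h_def f_inv_into_f intro: inv_into_into[of s \<psi> "{..<56}", simplified])
  have "cycle_in klein_graph (map h xs)"
    unfolding cycle_in_def
  proof
    show "distinct (map h xs)"
      using assms(1) \<psi>h by (auto simp: distinct_map cycle_in_def inj_on_def) metis
    show "parcs (cyc (map h xs)) \<subseteq> parcs klein_graph"
    proof
      fix a assume "a \<in> parcs (cyc (map h xs))"
      then obtain s t where st: "a = (h s, h t)" "(s, t) \<in> parcs (cyc xs)"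
        by (auto simp: map_graph_cyc[symmetric] map_graph_def)
      then have "s \<in> set xs" "t \<in> set xs" by (auto simp: cyc_def dest: set_zip_leftD set_zip_rightD)
      moreover have "adj s t" using st assms(1) by (auto simp: cycle_in_def)
      ultimately have "karc (h s) (h t)" using L(4)[of "h s" "h t"] \<psi>h by simp
      then show "a \<in> parcs klein_graph" using st by simp
    qed
  qed
  moreover have "h x = 0" "h y = 1" "h z = 2" using h[of 0] h[of 1] h[of 2] \<psi> by simp_all
  ultimately have "map h ys = [3, 4, 5, 6]"
    using klein_cycle[of "map h ys"] assms(3) by (simp add: xs)
  then have e: "map h xs = [0, 1, 2, 3, 4, 5, 6]" using \<open>h x = 0\<close> \<open>h y = 1\<close> \<open>h z = 2\<close> by (simp add: xs)
  have "face (map \<psi> (map h xs))"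
    unfolding e by (rule L(1)) (simp add: klein_faces_eq)
  moreover have "map \<psi> (map h xs) = xs" using \<psi>h by (simp add: map_idI)
  ultimately show ?thesis by simp
qed

lemma faceD: "face xs \<Longrightarrow> length xs = 7" "face xs \<Longrightarrow> cycle_in G xs" "face xs \<Longrightarrow> scyc xs \<in> F"
  by (auto simp: face_def)

lemma copies_eq_faces: "copies (cycle_graph 7) G = F"
proof
  show "copies (cycle_graph 7) G \<subseteq> F"
    using cycle_face by (auto simp: copies_cycle_graph[OF pair_sym_digraph] face_def)
qed (rule heptagons)

lemma ex_face: obtains x0 x1 x2 x3 x4 x5 x6 where "face [x0, x1, x2, x3, x4, x5, x6]"
proof -
  have "pverts G \<noteq> {}" using card56 by auto
  then obtain v where "v \<in> pverts G" by blast
  then have "card {u. adj v u} = 3" by (rule card_nbrs)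
  then obtain x y where "adj v x" "adj v y" "x \<noteq> y" by (auto simp: card_3_iff)
  then have "corner x v y" using adj_sym by auto
  then show ?thesis using face_ex that by metis
qed

lemma girth7: "girth G = 7"
proof -
  let ?S = "{k. 3 \<le> k \<and> copies (cycle_graph k) G \<noteq> {}}"
  obtain x0 x1 x2 x3 x4 x5 x6 where "face [x0, x1, x2, x3, x4, x5, x6]" by (rule ex_face)
  then have "7 \<in> ?S" using copies_eq_faces by (auto simp: face_def)
  moreover have "7 \<le> k" if k: "k \<in> ?S" for k
  proof (rule ccontr)
    assume "\<not> 7 \<le> k"
    moreover obtain xs where "length xs = k" "cycle_in G xs"
      using k copies_cycle_graph[OF pair_sym_digraph, of k] by auto
    ultimately show False using cycle_face[of xs] faceD(1)[of xs] k by auto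
  qed
  ultimately have m: "7 \<in> ?S" "\<And>k. k \<in> ?S \<Longrightarrow> 7 \<le> k" by blast+
  have "Inf (enat ` ?S) \<le> enat 7" by (intro Inf_lower imageI m(1))
  moreover have "enat 7 \<le> Inf (enat ` ?S)"
  proof (rule Inf_greatest)
    fix x assume "x \<in> enat ` ?S"
    then obtain k where "k \<in> ?S" "x = enat k" by blast
    then show "enat 7 \<le> x" using m(2) by simp
  qed
  ultimately show ?thesis by (simp add: girth_def numeral_eq_enat)
qed

text \<open>Both labellings carry the model onto \<open>G\<close> and its faces onto
  \<open>F\<close>, so one of them after the inverse of the other preserves the map.\<close>

lemma labels_aut:
  assumes "labels \<psi>" "labels \<psi>'"
  obtains g where "map_aut g G F" "\<And>n. n < 56 \<Longrightarrow> g (\<psi> n) = \<psi>' n"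
proof -
  note L = labelsD[OF assms(1)] and L' = labelsD[OF assms(2)]
  have pv: "pverts klein_graph = {..<56}" by (simp add: klein_graph_def)
  define g where "g = \<psi>' \<circ> inv_into {..<56} \<psi>"
  have g: "g (\<psi> n) = \<psi>' n" if "n < 56" for n using L(2) that by (simp add: g_def)
  have "graph_iso (inv_into {..<56} \<psi>) G klein_graph"
    using graph_iso_inv[OF L(5) klein_graph_wf] by (simp add: pv)
  then have "graph_aut g G" unfolding g_def by (rule graph_iso_comp[OF _ L'(5)])
  moreover have "map_graph g ` F = F"
  proof -
    have "map g (map \<psi> xs) = map \<psi>' xs" if "xs \<in> set klein_faces" for xs
      using klein_faceD(3)[OF that] g by auto
    then have "map_graph g ` (\<lambda>xs. scyc (map \<psi> xs)) ` set klein_faces =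
        (\<lambda>xs. scyc (map \<psi>' xs)) ` set klein_faces"
      unfolding image_image map_graph_scyc by (intro image_cong refl) metis
    then show ?thesis using L(6) L'(6) by simp
  qed
  ultimately show ?thesis using that[of g] g by (simp add: map_aut_def)
qed

lemma labels_face:
  assumes "labels \<psi>" "face (\<psi> 0 # \<psi> 1 # \<psi> 2 # xs)"
  shows "xs = map \<psi> [3, 4, 5, 6]"
proof -
  have 1: "face [\<psi> 0, \<psi> 1, \<psi> 2, \<psi> 3, \<psi> 4, \<psi> 5, \<psi> 6]"
    using labelsD(1)[OF assms(1), of "[0, 1, 2, 3, 4, 5, 6]"] by (simp add: klein_faces_eq)
  obtain a b c d where "xs = [a, b, c, d]"
    using faceD(1)[OF assms(2)] by (auto simp: eval_nat_numeral length_Suc_conv)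
  then show ?thesis using face_unique[OF assms(2)[unfolded \<open>xs = [a, b, c, d]\<close>] 1] by simp
qed

text \<open>Start and direction of the list are free, so rotations and reflections of every heptagon
  are covered at once.\<close>

lemma ex_labels_cycle:
  assumes "cycle_in G xs" "length xs = 7"
  obtains \<psi> where "labels \<psi>" "xs = map \<psi> [0, 1, 2, 3, 4, 5, 6]"
proof -
  obtain a b c d e f g where x: "xs = [a, b, c, d, e, f, g]" using assms(2) by (rule length7E)
  have fc: "face [a, b, c, d, e, f, g]" using cycle_face assms x by simp
  have "corner a b c" using face_adj[OF fc] by simp
  then obtain \<psi> where \<psi>: "labels \<psi>" "\<psi> 0 = a" "\<psi> 1 = b" "\<psi> 2 = c" by (rule ex_labels)
  have "[d, e, f, g] = map \<psi> [3, 4, 5, 6]"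
    using labels_face[OF \<psi>(1), unfolded \<psi>(2-4)] fc by blast
  then show ?thesis using that \<psi> x by simp
qed

lemma cycle_aut:
  assumes "cycle_in G xs" "length xs = 7" "cycle_in G ys" "length ys = 7"
  obtains g where "map_aut g G F" "map g xs = ys"
proof -
  obtain \<psi> where 1: "labels \<psi>" "xs = map \<psi> [0, 1, 2, 3, 4, 5, 6]" using ex_labels_cycle assms(1,2) by metis
  obtain \<psi>' where 2: "labels \<psi>'" "ys = map \<psi>' [0, 1, 2, 3, 4, 5, 6]" using ex_labels_cycle assms(3,4) by metis
  obtain g where "map_aut g G F" "\<And>n. n < 56 \<Longrightarrow> g (\<psi> n) = \<psi>' n" using labels_aut 1(1) 2(1) by metis
  then show ?thesis using that 1(2) 2(2) by simp
qed

lemma arc_aut: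
  assumes "adj u v" "adj u' v'"
  obtains g where "graph_aut g G" "g u = u'" "g v = v'"
proof -
  have ex: "\<exists>w. corner x y w" if "adj x y" for x y
  proof -
    have "card {z. adj y z} = 3" using card_nbrs adj_verts that by blast
    then obtain z z' where "adj y z" "adj y z'" "z \<noteq> z'" by (auto simp: card_3_iff)
    then show ?thesis using that by metis
  qed
  obtain w w' where c: "corner u v w" "corner u' v' w'" using ex assms by metis
  obtain \<psi> where 1: "labels \<psi>" "\<psi> 0 = u" "\<psi> 1 = v" using ex_labels[OF c(1)] by metis
  obtain \<psi>' where 2: "labels \<psi>'" "\<psi>' 0 = u'" "\<psi>' 1 = v'" using ex_labels[OF c(2)] by metis
  obtain g where "map_aut g G F" "\<And>n. n < 56 \<Longrightarrow> g (\<psi> n) = \<psi>' n" using labels_aut 1(1) 2(1) by metis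
  then show ?thesis using that[of g] 1(2,3) 2(2,3) by (auto simp: map_aut_def)
qed

end

section \<open>Ultrahomogeneity\<close>

lemma parcs_cyc_map: "parcs (cyc (map f xs)) = map_prod f f ` parcs (cyc xs)"
  by (simp add: map_graph_cyc[symmetric] map_graph_def)

lemma induced_copies_subset: "induced_copies X G \<subseteq> copies X G"
  by (auto simp: induced_copies_def)

lemma parcs_copies: "H \<in> copies X G \<Longrightarrow> parcs H \<subseteq> parcs G"
  by (auto simp: copies_def subgraph_with_proj_iff)

lemma parcs_cyc_subset_scyc: "parcs (cyc xs) \<subseteq> parcs (scyc xs)"
  by (auto simp: parcs_mk_symmetric_with_proj)

lemma parcs_graph_iso: "graph_iso f G H \<Longrightarrow> parcs H = map_prod f f ` parcs G"
  by (auto simp: graph_iso_def map_graph_def)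

lemma arc_not_in_cyc7: "cycle_in G [u, v, c, d, e, p, q] \<Longrightarrow> (v, u) \<notin> parcs (cyc [u, v, c, d, e, p, q])"
  by (auto simp: cycle_in_def parcs_cyc7)

lemma parcs_cyc_verts: "(x, y) \<in> parcs (cyc xs) \<Longrightarrow> x \<in> pverts (cyc xs) \<and> y \<in> pverts (cyc xs)"
  by (auto simp: cyc_def dest: set_zip_leftD set_zip_rightD)

lemma parcs_scyc_verts: "(x, y) \<in> parcs (scyc xs) \<Longrightarrow> x \<in> pverts (scyc xs) \<and> y \<in> pverts (scyc xs)"
  using parcs_cyc_verts[of _ _ xs] by (auto simp: parcs_mk_symmetric_with_proj)

context klein_map_rules begin

text \<open>The image list is again a cycle, and \<open>cycle_aut\<close> matches lists vertex by
  vertex. Only the arcs of one direction are mentioned, so this serves oriented and unoriented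
  cycles alike.\<close>

lemma extend_cycle_map:
  assumes "cycle_in G xs" "length xs = 7" "inj_on f (set xs)" "map_prod f f ` parcs (cyc xs) \<subseteq> parcs G"
  shows "\<exists>g. graph_aut g G \<and> (\<forall>v\<in>set xs. g v = f v)"
proof -
  have "cycle_in G (map f xs)"
    using assms by (simp add: cycle_in_def parcs_cyc_map distinct_map)
  then obtain g where "map_aut g G F" "map g xs = map f xs"
    using cycle_aut[OF assms(1,2), of "map f xs"] assms(2) by auto
  then show ?thesis by (auto simp: map_aut_def)
qed

lemma UH_cycle_graph: "UH (cycle_graph 7) G"
  unfolding UH_def
proof (intro ballI allI impI)
  fix H1 H2 f
  assume H: "H1 \<in> induced_copies (cycle_graph 7) G" "H2 \<in> induced_copies (cycle_graph 7) G"
    and f: "graph_iso f H1 H2"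
  obtain xs where xs: "H1 = scyc xs" "length xs = 7" "cycle_in G xs"
    using H(1) induced_copies_subset copies_cycle_graph[OF pair_sym_digraph, of 7] by fastforce
  have "map_prod f f ` parcs (cyc xs) \<subseteq> parcs H2"
    unfolding parcs_graph_iso[OF f] xs(1) by (intro image_mono parcs_cyc_subset_scyc)
  moreover have "parcs H2 \<subseteq> parcs G" using H(2) induced_copies_subset parcs_copies by blast
  ultimately show "\<exists>g. graph_aut g G \<and> (\<forall>v\<in>pverts H1. g v = f v)"
    using extend_cycle_map[OF xs(3,2), of f] f by (simp add: xs(1) graph_iso_def)
qed

lemma UH_dicycle: "UH (dicycle 7) G"
  unfolding UH_def
proof (intro ballI allI impI)
  fix H1 H2 f
  assume H: "H1 \<in> induced_copies (dicycle 7) G" "H2 \<in> induced_copies (dicycle 7) G"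
    and f: "graph_iso f H1 H2"
  obtain xs where xs: "H1 = cyc xs" "length xs = 7" "cycle_in G xs"
    using H(1) induced_copies_subset copies_dicycle[OF pair_wf_digraph, of 7] by fastforce
  have "map_prod f f ` parcs (cyc xs) = parcs H2"
    using parcs_graph_iso[OF f] xs(1) by simp
  moreover have "parcs H2 \<subseteq> parcs G" using H(2) induced_copies_subset parcs_copies by blast
  ultimately show "\<exists>g. graph_aut g G \<and> (\<forall>v\<in>pverts H1. g v = f v)"
    using extend_cycle_map[OF xs(3,2), of f] f by (simp add: xs(1) graph_iso_def)
qed

text \<open>A map on two vertices is known from its values on one arc, so \<open>arc_aut\<close>
  settles the edge and the single arc together.\<close>

lemma UH_of_arc:
  assumes "\<And>H. H \<in> copies X G \<Longrightarrow> \<exists>u v. pverts H = {u, v} \<and> (u, v) \<in> parcs H"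
  shows "UH X G"
  unfolding UH_def
proof (intro ballI allI impI)
  fix H1 H2 f
  assume H: "H1 \<in> induced_copies X G" "H2 \<in> induced_copies X G" and f: "graph_iso f H1 H2"
  obtain u v where uv: "pverts H1 = {u, v}" "(u, v) \<in> parcs H1"
    using assms[OF subsetD[OF induced_copies_subset H(1)]] by (elim exE conjE)
  have sub: "parcs H1 \<subseteq> parcs G" "parcs H2 \<subseteq> parcs G"
    using H induced_copies_subset parcs_copies by blast+
  have "map_prod f f (u, v) \<in> parcs H2" unfolding parcs_graph_iso[OF f] using uv(2) by (rule imageI)
  then have "adj u v" "adj (f u) (f v)" using sub uv(2) by auto
  then obtain g where "graph_aut g G" "g u = f u" "g v = f v"
    using arc_aut[of u v "f u" "f v"] by metis
  then show "\<exists>g. graph_aut g G \<and> (\<forall>v\<in>pverts H1. g v = f v)" using uv(1) by auto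
qed

lemma UH_path_graph: "UH (path_graph 2) G"
  by (rule UH_of_arc, erule copies_path_graph2) auto

lemma UH_dipath: "UH (dipath 2) G"
  by (rule UH_of_arc, erule copies_dipath2) auto

text \<open>The common core of both uniqueness claims: \<open>u\<close> has one neighbour besides
  \<open>v\<close> and \<open>s\<close>, and three consecutive vertices determine a 7-cycle.\<close>

lemma opposite_cycle:
  assumes "cycle_in G [u, v, w, p, q, r, s]"
  obtains a b c d e where "cycle_in G [v, u, a, b, c, d, e]" "distinct [u, v, w, p, q, r, s, a, b, c, d, e]"
    "\<And>t xs. cycle_in G (v # u # t # xs) \<Longrightarrow> length xs = 4 \<Longrightarrow> t \<noteq> s \<Longrightarrow> t # xs = [a, b, c, d, e]"
proof -
  obtain \<psi> where \<psi>: "labels \<psi>" "[u, v, w, p, q, r, s] = map \<psi> [0, 1, 2, 3, 4, 5, 6]"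
    using ex_labels_cycle[OF assms] by auto
  note L = labelsD[OF \<psi>(1)]
  \<comment> \<open>The model face on the other side of the edge between 0 and 1.\<close>
  have "face (map \<psi> [0, 7, 21, 28, 15, 8, 1])"
    by (rule L(1)) (simp add: klein_faces_eq)
  then have "face [\<psi> 0, \<psi> 7, \<psi> 21, \<psi> 28, \<psi> 15, \<psi> 8, \<psi> 1]" by simp
  then have o: "face [\<psi> 1, \<psi> 0, \<psi> 7, \<psi> 21, \<psi> 28, \<psi> 15, \<psi> 8]"
    by (rule face_rotate[OF face_rotate[OF face_rotate[OF face_rotate[OF face_rotate[OF face_rotate]]]]])
  have "distinct (map \<psi> [0, 1, 2, 3, 4, 5, 6, 7, 21, 28, 15, 8])"
    unfolding distinct_map by (intro conjI inj_on_subset[OF L(2)]) auto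
  then have d: "distinct [u, v, w, p, q, r, s, \<psi> 7, \<psi> 21, \<psi> 28, \<psi> 15, \<psi> 8]" using \<psi>(2) by simp
  have o': "face [v, u, \<psi> 7, \<psi> 21, \<psi> 28, \<psi> 15, \<psi> 8]" using o \<psi>(2) by simp
  have n: "adj u v" "adj u s" "adj u (\<psi> 7)"
    using assms face_adj(2)[OF o'] adj_sym[of s u] by (auto simp: cycle_in_def parcs_cyc7)
  show ?thesis
  proof (rule that[OF faceD(2)[OF o'] d])
    fix t xs assume t: "cycle_in G (v # u # t # xs)" "length xs = 4" "t \<noteq> s"
    have f: "face (v # u # t # xs)" using cycle_face t by simp
    obtain x y z x' where xs: "xs = [x, y, z, x']"
      using t(2) by (auto simp: eval_nat_numeral length_Suc_conv)
    have "adj u t" "t \<noteq> v" using face_adj[OF f[unfolded xs]] by auto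
    then have "t = \<psi> 7" using nbr_cases[OF n, of t] d t(3) by auto
    then show "t # xs = [\<psi> 7, \<psi> 21, \<psi> 28, \<psi> 15, \<psi> 8]"
      using face_unique[OF f[unfolded xs \<open>t = \<psi> 7\<close>] o'] xs by simp
  qed
qed

lemma UH_graph_klein: "UH_graph (cycle_graph 7) (path_graph 2) G"
  unfolding UH_graph_def
proof (intro conjI ballI UH_cycle_graph UH_path_graph)
  fix H0 M0 assume H0: "H0 \<in> copies (cycle_graph 7) G" and "M0 \<in> copies (path_graph 2) H0"
  then obtain u v where uv: "u \<noteq> v" "pverts M0 = {u, v}" "parcs M0 = {(u, v), (v, u)}" "(u, v) \<in> parcs H0"
    by (metis copies_path_graph2)
  obtain w p q r s where f0: "face [u, v, w, p, q, r, s]" and h0: "H0 = scyc [u, v, w, p, q, r, s]"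
    using face_through_arc[of H0 u v] H0 uv(4) copies_eq_faces by blast
  obtain a b c d e where C: "cycle_in G [v, u, a, b, c, d, e]" "distinct [u, v, w, p, q, r, s, a, b, c, d, e]"
    "\<And>t xs. cycle_in G (v # u # t # xs) \<Longrightarrow> length xs = 4 \<Longrightarrow> t \<noteq> s \<Longrightarrow> t # xs = [a, b, c, d, e]"
    using opposite_cycle[OF faceD(2)[OF f0]] by metis
  let ?H1 = "scyc [v, u, a, b, c, d, e]"
  have 1: "?H1 \<in> copies (cycle_graph 7) G"
    using C(1) by (auto simp: copies_cycle_graph[OF pair_sym_digraph] simp del: scyc7_rotate)
  have 2: "pverts H0 \<inter> pverts ?H1 = {u, v}" using C(2) by (auto simp: h0)
  have 3: "parcs H0 \<inter> parcs ?H1 = {(u, v), (v, u)}"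
  proof
    show "parcs H0 \<inter> parcs ?H1 \<subseteq> {(u, v), (v, u)}"
    proof
      fix z assume z: "z \<in> parcs H0 \<inter> parcs ?H1"
      obtain x y where xy: "z = (x, y)" by (cases z)
      have "x \<in> pverts H0 \<inter> pverts ?H1" "y \<in> pverts H0 \<inter> pverts ?H1"
        using z parcs_scyc_verts[of x y] unfolding xy h0 by blast+
      moreover have "x \<noteq> y" using z parcs_copies[OF 1] adj_irrefl[of x] xy by auto
      ultimately show "z \<in> {(u, v), (v, u)}" unfolding 2 xy by auto
    qed
    show "{(u, v), (v, u)} \<subseteq> parcs H0 \<inter> parcs ?H1" by (simp add: h0 parcs_scyc7)
  qed
  show "\<exists>!H1. H1 \<in> copies (cycle_graph 7) G \<and> H1 \<noteq> H0 \<and>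
      pverts H0 \<inter> pverts H1 = pverts M0 \<and> parcs H0 \<inter> parcs H1 = parcs M0"
  proof (rule ex1I[of _ ?H1])
    have "a \<in> pverts ?H1" "a \<notin> pverts H0" using C(2) by (auto simp: h0)
    then show "?H1 \<in> copies (cycle_graph 7) G \<and> ?H1 \<noteq> H0 \<and>
      pverts H0 \<inter> pverts ?H1 = pverts M0 \<and> parcs H0 \<inter> parcs ?H1 = parcs M0"
      using 1 2 3 uv by blast
  next
    fix H1 assume H1: "H1 \<in> copies (cycle_graph 7) G \<and> H1 \<noteq> H0 \<and>
      pverts H0 \<inter> pverts H1 = pverts M0 \<and> parcs H0 \<inter> parcs H1 = parcs M0"
    then have "(v, u) \<in> parcs H1" using uv(3) by blast
    then obtain t x y z z' where f1: "face [v, u, t, x, y, z, z']" and h1: "H1 = scyc [v, u, t, x, y, z, z']"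
      using face_through_arc[of H1 v u] H1 copies_eq_faces by blast
    \<comment> \<open>Continuing to \<open>s\<close> would give the two heptagons a third common
      vertex.\<close>
    have "t \<in> pverts H1" "t \<noteq> u" "t \<noteq> v" using face_adj(8)[OF f1] by (auto simp: h1)
    then have "t \<notin> pverts H0" using H1 uv(2) by blast
    then have "t \<noteq> s" by (auto simp: h0)
    then show "H1 = ?H1" using C(3)[OF faceD(2)[OF f1]] h1 by simp
  qed
qed

lemma UH_digraph_klein: "UH_digraph (dicycle 7) (dipath 2) G"
  unfolding UH_digraph_def
proof (intro conjI ballI UH_dicycle UH_dipath)
  note cd = copies_dicycle[OF pair_wf_digraph, of 7, simplified]
  fix H0 M0 assume H0: "H0 \<in> copies (dicycle 7) G" and "M0 \<in> copies (dipath 2) H0"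
  then obtain u v where uv: "u \<noteq> v" "pverts M0 = {u, v}" "parcs M0 = {(u, v)}" "(u, v) \<in> parcs H0"
    by (metis copies_dipath2)
  obtain xs where "cycle_in G xs" "length xs = 7" "H0 = cyc xs" using H0 cd by auto
  then obtain w p q r s where f0: "cycle_in G [u, v, w, p, q, r, s]" and h0: "H0 = cyc [u, v, w, p, q, r, s]"
    using cycle_through_arc[of G xs u v] uv(4) by metis
  obtain a b c d e where C: "cycle_in G [v, u, a, b, c, d, e]" "distinct [u, v, w, p, q, r, s, a, b, c, d, e]"
    "\<And>t xs. cycle_in G (v # u # t # xs) \<Longrightarrow> length xs = 4 \<Longrightarrow> t \<noteq> s \<Longrightarrow> t # xs = [a, b, c, d, e]"
    using opposite_cycle[OF f0] by metis
  let ?H1 = "cyc [v, u, a, b, c, d, e]"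
  have 1: "?H1 \<in> copies (dicycle 7) G" using C(1) by (auto simp: cd)
  have 2: "pverts H0 \<inter> pverts ?H1 = {u, v}" using C(2) by (auto simp: h0)
  have 3: "parcs H0 \<inter> (parcs ?H1)\<inverse> = {(u, v)}"
  proof
    show "parcs H0 \<inter> (parcs ?H1)\<inverse> \<subseteq> {(u, v)}"
    proof
      fix z assume z: "z \<in> parcs H0 \<inter> (parcs ?H1)\<inverse>"
      obtain x y where xy: "z = (x, y)" by (cases z)
      have "x \<in> pverts H0 \<inter> pverts ?H1" "y \<in> pverts H0 \<inter> pverts ?H1"
        using z parcs_cyc_verts[of x y] parcs_cyc_verts[of y x] unfolding xy h0 by blast+
      moreover have "x \<noteq> y" using z parcs_copies[OF H0] adj_irrefl[of x] xy by auto
      \<comment> \<open>The common vertices alone would still admit this arc; an oriented heptagon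
        contains only one of the two arcs of an edge.\<close>
      moreover have "z \<noteq> (v, u)" using z arc_not_in_cyc7[OF f0] h0 by auto
      ultimately show "z \<in> {(u, v)}" unfolding 2 xy by auto
    qed
    show "{(u, v)} \<subseteq> parcs H0 \<inter> (parcs ?H1)\<inverse>" by (simp add: h0 parcs_cyc7)
  qed
  show "\<exists>!H1. H1 \<in> copies (dicycle 7) G \<and> H1 \<noteq> H0 \<and>
      pverts H0 \<inter> pverts H1 = pverts M0 \<and> parcs H0 \<inter> (parcs H1)\<inverse> = parcs M0"
  proof (rule ex1I[of _ ?H1])
    have "a \<in> pverts ?H1" "a \<notin> pverts H0" using C(2) by (auto simp: h0)
    then show "?H1 \<in> copies (dicycle 7) G \<and> ?H1 \<noteq> H0 \<and>
      pverts H0 \<inter> pverts ?H1 = pverts M0 \<and> parcs H0 \<inter> (parcs ?H1)\<inverse> = parcs M0"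
      using 1 2 3 uv by blast
  next
    fix H1 assume H1: "H1 \<in> copies (dicycle 7) G \<and> H1 \<noteq> H0 \<and>
      pverts H0 \<inter> pverts H1 = pverts M0 \<and> parcs H0 \<inter> (parcs H1)\<inverse> = parcs M0"
    then have "(v, u) \<in> parcs H1" using uv(3) by blast
    moreover obtain ys where "cycle_in G ys" "length ys = 7" "H1 = cyc ys" using H1 cd by auto
    ultimately obtain t x y z z' where f1: "cycle_in G [v, u, t, x, y, z, z']" and h1: "H1 = cyc [v, u, t, x, y, z, z']"
      using cycle_through_arc[of G ys v u] by metis
    have "t \<in> pverts H1" "t \<noteq> u" "t \<noteq> v" using f1 by (auto simp: h1 cycle_in_def)
    then have "t \<notin> pverts H0" using H1 uv(2) by blast
    then have "t \<noteq> s" by (auto simp: h0)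
    then show "H1 = ?H1" using C(3)[OF f1] h1 by simp
  qed
qed

end

section \<open>The Klein map\<close>

lemma klein_faces_set_inj:
  assumes "xs \<in> set klein_faces" "ys \<in> set klein_faces" "set xs = set ys"
  shows "xs = ys"
proof -
  have "list_all (\<lambda>x. x \<in> set ys) (take 3 xs)"
    using assms(3) by (auto simp: list_all_iff dest: in_set_takeD)
  moreover have "list_all (\<lambda>x. x \<in> set ys) (take 3 xs) \<longrightarrow> xs = ys"
    using klein_faces_inj_check assms(1,2) unfolding list_all_iff by blast
  ultimately show ?thesis by blast
qed

context klein_map_rules begin

section \<open>Number and coherent orientation of the faces\<close>

context
  fixes \<psi> assumes \<psi>: "labels \<psi>"
begin

lemmas label_props = labelsD[OF \<psi>]

lemma inj_on_scyc_labels: "inj_on (\<lambda>xs. scyc (map \<psi> xs)) (set klein_faces)"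
proof (rule inj_onI)
  fix xs ys assume xs: "xs \<in> set klein_faces" and ys: "ys \<in> set klein_faces"
    and "scyc (map \<psi> xs) = scyc (map \<psi> ys)"
  then have "pverts (scyc (map \<psi> xs)) = pverts (scyc (map \<psi> ys))" by simp
  then have "\<psi> ` set xs = \<psi> ` set ys" by simp
  then have "set xs = set ys"
    using inj_on_image_eq_iff[OF label_props(2)] klein_faceD(3)[OF xs] klein_faceD(3)[OF ys] by metis
  with xs ys show "xs = ys" by (rule klein_faces_set_inj)
qed

lemma card_faces: "card F = 24"
proof -
  have "card F = card (set klein_faces)" unfolding label_props(6) by (rule card_image[OF inj_on_scyc_labels])
  also have "\<dots> = length klein_faces" by (rule distinct_card[OF distinct_klein_faces])
  finally show ?thesis by (simp add: klein_faces_eq)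
qed

text \<open>Of the two directions of each heptagon, the one listed in the model; this is the witness
  for the 24 oriented cycles.\<close>

definition oriented_faces where
  "oriented_faces = (\<lambda>xs. cyc (map \<psi> xs)) ` set klein_faces"

lemma oriented_faces_subset: "oriented_faces \<subseteq> copies (dicycle 7) G"
  using label_props(1) by (auto simp: oriented_faces_def copies_dicycle[OF pair_wf_digraph] face_def)

lemma bij_betw_oriented_faces: "bij_betw (\<lambda>C. mk_symmetric (with_proj C)) oriented_faces F"
proof -
  have "inj_on (\<lambda>C. mk_symmetric (with_proj C)) oriented_faces"
  proof (rule inj_onI)
    fix C D assume "C \<in> oriented_faces" "D \<in> oriented_faces"
      and e: "mk_symmetric (with_proj C) = mk_symmetric (with_proj D)"
    then obtain xs ys where xs: "xs \<in> set klein_faces" "C = cyc (map \<psi> xs)"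
      and ys: "ys \<in> set klein_faces" "D = cyc (map \<psi> ys)" by (auto simp: oriented_faces_def)
    have "scyc (map \<psi> xs) = scyc (map \<psi> ys)" using e unfolding xs ys .
    then have "xs = ys" using inj_onD[OF inj_on_scyc_labels] xs(1) ys(1) by blast
    then show "C = D" using xs ys by simp
  qed
  moreover have "(\<lambda>C. mk_symmetric (with_proj C)) ` oriented_faces = F"
    unfolding oriented_faces_def image_image label_props(6) ..
  ultimately show ?thesis by (simp add: bij_betw_def)
qed

lemma card_oriented_faces: "card oriented_faces = 24"
  using bij_betw_same_card[OF bij_betw_oriented_faces] card_faces by simp

lemma oriented_face_ex1:
  assumes "a \<in> parcs G"
  shows "\<exists>!C. C \<in> oriented_faces \<and> a \<in> parcs C"
proof -
  obtain s t where st: "a = (s, t)" "adj s t" using assms by (cases a) auto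
  have "s \<in> \<psi> ` {..<56}" "t \<in> \<psi> ` {..<56}" using adj_verts[OF st(2)] by (simp_all add: label_props(3))
  then obtain u v where uv: "s = \<psi> u" "t = \<psi> v" "u < 56" "v < 56" by auto
  have k: "karc u v" using label_props(4)[OF uv(3,4)] st(2) uv(1,2) by simp
  have iff: "a \<in> parcs (cyc (map \<psi> xs)) \<longleftrightarrow> (u, v) \<in> parcs (cyc xs)" if xs: "xs \<in> set klein_faces" for xs
  proof
    assume "a \<in> parcs (cyc (map \<psi> xs))"
    then obtain u' v' where u': "(u', v') \<in> parcs (cyc xs)" "\<psi> u = \<psi> u'" "\<psi> v = \<psi> v'"
      unfolding parcs_cyc_map st uv by auto
    then have "u' < 56" "v' < 56" using parcs_cyc_verts[OF u'(1)] klein_faceD(3)[OF xs] by auto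
    then have "u = u'" "v = v'" using inj_onD[OF label_props(2)] u'(2,3) uv(3,4) by auto
    then show "(u, v) \<in> parcs (cyc xs)" using u'(1) by simp
  next
    assume "(u, v) \<in> parcs (cyc xs)"
    then have "map_prod \<psi> \<psi> (u, v) \<in> parcs (cyc (map \<psi> xs))" unfolding parcs_cyc_map by (rule imageI)
    then show "a \<in> parcs (cyc (map \<psi> xs))" by (simp add: st uv)
  qed
  obtain xs where xs: "xs \<in> set klein_faces" "(u, v) \<in> parcs (cyc xs)"
    and un: "\<And>ys. ys \<in> set klein_faces \<and> (u, v) \<in> parcs (cyc ys) \<Longrightarrow> ys = xs"
    using klein_face_ex1[OF k] by (metis (no_types, lifting))
  show ?thesis
  proof (rule ex1I[of _ "cyc (map \<psi> xs)"])
    show "cyc (map \<psi> xs) \<in> oriented_faces \<and> a \<in> parcs (cyc (map \<psi> xs))"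
      using xs iff[OF xs(1)] by (simp add: oriented_faces_def)
    fix C assume C: "C \<in> oriented_faces \<and> a \<in> parcs C"
    then obtain ys where ys: "ys \<in> set klein_faces" "C = cyc (map \<psi> ys)" by (auto simp: oriented_faces_def)
    then have "ys = xs" using un[of ys] iff[OF ys(1)] C by simp
    then show "C = cyc (map \<psi> xs)" using ys by simp
  qed
qed

lemma orientable_faces: "orientable F"
proof -
  define ori where "ori = inv_into oriented_faces (\<lambda>C. mk_symmetric (with_proj C))"
  have o: "ori f \<in> oriented_faces" "mk_symmetric (with_proj (ori f)) = f" if "f \<in> F" for f
    using bij_betw_oriented_faces that unfolding ori_def bij_betw_def
    by (auto intro: inv_into_into f_inv_into_f)
  have "oriented_cycle (ori f) f" if f: "f \<in> F" for f
  proof -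
    obtain xs where xs: "ori f = cyc xs" "length xs = 7" "cycle_in G xs"
      using o(1)[OF f] oriented_faces_subset by (auto simp: copies_dicycle[OF pair_wf_digraph])
    have fx: "f = scyc xs" using o(2)[OF f] xs(1) by simp
    have "pair_wf_digraph f"
      unfolding fx
      by (intro wf_digraph.wellformed_mk_symmetric pair_wf_digraph_imp_wf_digraph pair_wf_digraph_cyc)
    moreover have "cycle_in f xs" using xs(3) parcs_cyc_subset_scyc by (auto simp: cycle_in_def fx)
    ultimately have "ori f \<in> copies (dicycle 7) f"
      using xs(1,2) by (auto simp: copies_dicycle)
    then show ?thesis using o(2)[OF f] by (auto simp: oriented_cycle_def intro: exI[of _ 7])
  qed
  moreover have "parcs (ori f) \<inter> parcs (ori g) = {}" if "f \<in> F" "g \<in> F" "f \<noteq> g" for f g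
  proof (rule ccontr)
    assume "parcs (ori f) \<inter> parcs (ori g) \<noteq> {}"
    then obtain a where a: "a \<in> parcs (ori f)" "a \<in> parcs (ori g)" by blast
    then have "a \<in> parcs G" using parcs_copies oriented_faces_subset o(1)[OF that(1)] by blast
    then have "ori f = ori g" using oriented_face_ex1 a o(1) that(1,2) by metis
    then show False using o(2) that by metis
  qed
  ultimately show ?thesis unfolding orientable_def by blast
qed

lemma card_faces_at_vertex:
  assumes "v \<in> pverts G"
  shows "card {f \<in> F. v \<in> pverts f} = 3"
proof -
  obtain n where n: "v = \<psi> n" "n < 56" using assms unfolding label_props(3)[symmetric] by auto
  have iff: "v \<in> pverts (scyc (map \<psi> xs)) \<longleftrightarrow> n \<in> set xs" if "xs \<in> set klein_faces" for xs
    using inj_on_image_mem_iff[OF label_props(2), of n "set xs"] klein_faceD(3)[OF that] n by simp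
  have "{f \<in> F. v \<in> pverts f} = (\<lambda>xs. scyc (map \<psi> xs)) ` set (filter (\<lambda>xs. n \<in> set xs) klein_faces)"
    unfolding label_props(6) using iff by auto
  then have "card {f \<in> F. v \<in> pverts f} = card (set (filter (\<lambda>xs. n \<in> set xs) klein_faces))"
    using card_image inj_on_subset[OF inj_on_scyc_labels, of "set (filter (\<lambda>xs. n \<in> set xs) klein_faces)"]
    by (metis (no_types, lifting) filter_is_subset)
  also have "\<dots> = length (filter (\<lambda>xs. n \<in> set xs) klein_faces)"
    by (intro distinct_card distinct_filter distinct_klein_faces)
  also have "\<dots> = 3" using klein_faces_at_vertex_check n(2) by (simp add: list_all_iff)
  finally show ?thesis .
qed

end

section \<open>Surface, regularity and Petrie length\<close>

lemma labels_exist: obtains \<psi> where "labels \<psi>"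
proof -
  obtain x0 x1 x2 x3 x4 x5 x6 where "face [x0, x1, x2, x3, x4, x5, x6]" by (rule ex_face)
  from face_adj[OF this] have "corner x0 x1 x2" by simp
  then show ?thesis using ex_labels that by metis
qed

lemma surface_map_faces: "surface_map G F"
  unfolding surface_map_def
proof (intro conjI ballI allI impI)
  show "pair_graph G" "Digraph_Component.connected (with_proj G)" by (rule graph, rule conn)
  obtain x0 x1 x2 x3 x4 x5 x6 where "face [x0, x1, x2, x3, x4, x5, x6]" by (rule ex_face)
  from face_adj(1)[OF this] show "parcs G \<noteq> {}" by blast
  show "F \<subseteq> (\<Union>k\<in>{3..}. copies (cycle_graph k) G)" using heptagons by force
  fix v u w assume a: "adj v u" "adj v w"
  show "(u, w) \<in> (corners F v)\<^sup>*"
  proof (cases "u = w")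
    case False
    then have "corner u v w" using a adj_sym[OF a(1)] by simp
    \<comment> \<open>Vertex links are triangles: any two distinct neighbours already form a corner,
      so one step connects them.\<close>
    then have "(u, w) \<in> corners F v" using corner_face_ex1 False unfolding corners_def by blast
    then show ?thesis by blast
  qed simp
qed (rule two_faces)

text \<open>A flag amounts to the vertex list of its face that starts with its arc, so transitivity
  on flags is \<open>cycle_aut\<close>.\<close>

lemma regular_map_faces: "regular_map G F"
  unfolding regular_map_def
proof (intro conjI ballI surface_map_faces, clarify)
  fix f g u v u' v'
  assume f: "f \<in> F" "(u, v) \<in> parcs f" and g: "g \<in> F" "(u', v') \<in> parcs g"
  obtain c d e p q where 1: "face [u, v, c, d, e, p, q]" "f = scyc [u, v, c, d, e, p, q]"
    using face_through_arc[OF f] by blast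
  obtain c' d' e' p' q' where 2: "face [u', v', c', d', e', p', q']" "g = scyc [u', v', c', d', e', p', q']"
    using face_through_arc[OF g] by blast
  obtain \<phi> where \<phi>: "map_aut \<phi> G F" "map \<phi> [u, v, c, d, e, p, q] = [u', v', c', d', e', p', q']"
    using cycle_aut[OF faceD(2,1)[OF 1(1)] faceD(2,1)[OF 2(1)]] by metis
  have "map_graph \<phi> f = g" unfolding 1(2) 2(2) map_graph_scyc \<phi>(2) ..
  then show "\<exists>\<phi>. map_aut \<phi> G F \<and> \<phi> u = u' \<and> \<phi> v = v' \<and> map_graph \<phi> f = g"
    using \<phi> by (intro exI[of _ \<phi>]) simp
qed

lemma petrie_walk_adj:
  assumes "petrie_walk F w"
  shows "adj (w i) (w (i + 1))" "w i \<noteq> w (i + 2)"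
proof -
  obtain f where "f \<in> F" "(w i, w (i + 1)) \<in> parcs f"
    using assms unfolding petrie_walk_def by blast
  then show "adj (w i) (w (i + 1))" using heptagons parcs_copies by blast
  show "w i \<noteq> w (i + 2)" using assms unfolding petrie_walk_def by blast
qed

text \<open>Modulo 8 the number 4 is a multiple of each \<open>n\<close> from 1 to 7, so a shorter
  period makes the walk close after four steps, which yields a 4-cycle.\<close>

lemma petrie_walk_period:
  assumes "petrie_walk F w" "n < 8"
  shows "\<not> has_period w n"
proof
  assume n: "has_period w n"
  have mult: "w (i + m * k) = w i" if "has_period w k" for i m k
  proof (induction m)
    case (Suc m)
    have "w (i + Suc m * k) = w ((i + m * k) + k)" by (simp add: algebra_simps)
    then show ?case using that Suc by (simp add: has_period_def)
  qed simp
  note m8 = mult[OF petrie[OF assms(1)]] and mn = mult[OF n]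
  have "n \<in> {1, 2, 3, 4, 5, 6, 7}" using n assms(2) by (auto simp: has_period_def)
  then have "w (0 + 4 * 1) = w 0"
  proof (elim insertE emptyE)
    assume "n = 1" then show ?thesis using mn[of 0 4] by simp
  next
    assume "n = 2" then show ?thesis using mn[of 0 2] by simp
  next
    assume "n = 3" then show ?thesis using mn[of 0 4] m8[of 4 1] by simp
  next
    assume "n = 4" then show ?thesis using mn[of 0 1] by simp
  next
    assume "n = 5" then show ?thesis using mn[of 0 4] m8[of 4 2] by simp
  next
    assume "n = 6" then show ?thesis using mn[of 0 2] m8[of 4 1] by simp
  next
    assume "n = 7" then show ?thesis using mn[of 0 4] m8[of 4 3] by simp
  qed
  then have 4: "w 4 = w 0" by simp
  note p = petrie_walk_adj[OF assms(1)]
  have a: "adj (w 0) (w 1)" "adj (w 1) (w 2)" "adj (w 2) (w 3)" "adj (w 3) (w 0)" "w 0 \<noteq> w 2" "w 1 \<noteq> w 3"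
    using p(1)[of 0] p(1)[of 1] p(1)[of 2] p(1)[of 3] p(2)[of 0] p(2)[of 1] 4
    by (simp_all add: eval_nat_numeral)
  have "cycle_in G [w 0, w 1, w 2, w 3]"
    using a adj_irrefl by (auto simp: cycle_in_def cyc_def)
  then show False using cycle_face[of "[w 0, w 1, w 2, w 3]"] faceD(1)[of "[w 0, w 1, w 2, w 3]"] by simp
qed

lemma klein_map_faces: "klein_map G F"
proof -
  obtain \<psi> where \<psi>: "labels \<psi>" by (rule labels_exist)
  show ?thesis
    unfolding regular_map_of_type_def
    using regular_map_faces heptagons card_faces_at_vertex[OF \<psi>] petrie petrie_walk_period by blast
qed

end

lemma klein_map_rules_of_klein_cubic_graph:
  assumes "klein_cubic_graph G" "klein_map G F"
  shows "klein_map_rules G F"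
proof -
  have 1: "pair_graph G" "card (pverts G) = 56" "\<And>v. v \<in> pverts G \<Longrightarrow> out_degree (with_proj G) v = 3"
    using assms(1) by (simp_all add: klein_cubic_graph_def)
  have s: "surface_map G F" "F \<subseteq> copies (cycle_graph 7) G" "\<And>w. petrie_walk F w \<Longrightarrow> has_period w 8"
    using assms(2) by (simp_all add: regular_map_of_type_def regular_map_def)
  then have "Digraph_Component.connected (with_proj G)" "\<And>a. a \<in> parcs G \<Longrightarrow> card {f \<in> F. a \<in> parcs f} = 2"
    by (simp_all add: surface_map_def)
  then show ?thesis
    by (intro klein_map_rules.intro klein_rules.intro klein_map_rules_axioms.intro 1 s)
qed

section \<open>The model satisfies the local rules\<close>

abbreviation klein_graph_faces :: "nat pair_pre_digraph set" where
  "klein_graph_faces \<equiv> scyc ` set klein_faces"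

lemma karc_irrefl: "\<not> karc u u"
proof
  assume u: "karc u u"
  then have "u < 56" using karc_less by blast
  then obtain x y z where "nb u = [x, y, z]" "distinct [u, x, y, z]" by (metis nb_cases)
  then show False using u by (auto simp: karc_iff)
qed

lemma pair_graph_klein_graph: "pair_graph klein_graph"
proof -
  interpret pair_wf_digraph klein_graph by (rule klein_graph_wf)
  have "finite (parcs klein_graph)"
    using card_parcs_klein_graph by (metis card.infinite zero_neq_numeral)
  moreover have "symmetric (with_proj klein_graph)"
    unfolding symmetric_def by (rule symI) (simp add: karc_sym)
  moreover have "fst e \<noteq> snd e" if "e \<in> parcs klein_graph" for e
    using karc_irrefl[of "fst e"] that by (metis prod.collapse)
  ultimately show ?thesis by unfold_locales (simp_all add: klein_graph_def)
qed

lemma nbrs_klein_graph: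
  assumes "v < 56"
  shows "{u. karc v u} = set (nb v)"
proof -
  have "{u. karc v u} = {u. karc u v}" by (intro Collect_cong iffI) (erule karc_sym)+
  then show ?thesis using assms by (simp add: karc_iff)
qed

lemma out_degree_klein_graph:
  assumes "v \<in> pverts klein_graph"
  shows "out_degree (with_proj klein_graph) v = 3"
proof -
  have v: "v < 56" using assms by (simp add: klein_graph_def)
  have "out_arcs (with_proj klein_graph) v = Pair v ` {u. karc v u}" by (auto simp: out_arcs_def)
  then have "out_degree (with_proj klein_graph) v = card (set (nb v))"
    using v by (simp add: out_degree_def card_image inj_on_def nbrs_klein_graph)
  also have "\<dots> = 3"
  proof -
    obtain x y z where "nb v = [x, y, z]" "distinct [v, x, y, z]" by (metis nb_cases v)
    then show ?thesis by simp
  qed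
  finally show ?thesis .
qed

text \<open>One face lists the arc and one lists its reverse; they differ because an oriented
  heptagon never contains both.\<close>

lemma klein_faces_at_arc:
  assumes "karc u v"
  shows "card {f \<in> klein_graph_faces. (u, v) \<in> parcs f} = 2"
proof -
  obtain xs where xs: "xs \<in> set klein_faces" "(u, v) \<in> parcs (cyc xs)"
    and ux: "\<And>zs. zs \<in> set klein_faces \<and> (u, v) \<in> parcs (cyc zs) \<Longrightarrow> zs = xs"
    using klein_face_ex1[OF assms] by (metis (no_types, lifting))
  obtain ys where ys: "ys \<in> set klein_faces" "(v, u) \<in> parcs (cyc ys)"
    and uy: "\<And>zs. zs \<in> set klein_faces \<and> (v, u) \<in> parcs (cyc zs) \<Longrightarrow> zs = ys"
    using klein_face_ex1[OF karc_sym[OF assms]] by (metis (no_types, lifting))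
  have "(u, v) \<in> parcs (scyc zs) \<longleftrightarrow> (u, v) \<in> parcs (cyc zs) \<or> (v, u) \<in> parcs (cyc zs)" for zs
    by (simp add: parcs_mk_symmetric_with_proj)
  then have "zs \<in> set klein_faces \<and> (u, v) \<in> parcs (scyc zs) \<longleftrightarrow> zs = xs \<or> zs = ys" for zs
    using xs ys ux[of zs] uy[of zs] by metis
  then have "{zs \<in> set klein_faces. (u, v) \<in> parcs (scyc zs)} = {xs, ys}"
    by (simp only: set_eq_iff mem_Collect_eq) simp
  moreover have "{f \<in> klein_graph_faces. (u, v) \<in> parcs f} =
      scyc ` {zs \<in> set klein_faces. (u, v) \<in> parcs (scyc zs)}" by blast
  ultimately have "{f \<in> klein_graph_faces. (u, v) \<in> parcs f} = {scyc xs, scyc ys}" by simp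
  moreover have "xs \<noteq> ys"
  proof
    assume "xs = ys"
    obtain c d e p q where c: "cycle_in klein_graph [u, v, c, d, e, p, q]" "cyc xs = cyc [u, v, c, d, e, p, q]"
      using cycle_through_arc[OF klein_faceD(2,1)[OF xs(1)] xs(2)] by blast
    then show False using arc_not_in_cyc7[OF c(1)] ys(2) \<open>xs = ys\<close> by simp
  qed
  moreover have "scyc xs \<noteq> scyc ys"
  proof
    assume "scyc xs = scyc ys"
    then have "pverts (scyc xs) = pverts (scyc ys)" by simp
    then show False using klein_faces_set_inj[OF xs(1) ys(1)] \<open>xs \<noteq> ys\<close> by simp
  qed
  ultimately show ?thesis by simp
qed

text \<open>Two turns to the same side would follow a listed face, forwards or backwards, for three
  edges; hence the sides alternate.\<close>

lemma klein_petrie_step: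
  assumes w: "petrie_walk klein_graph_faces w"
  shows "karc (w i) (w (i + 1))"
    "w (i + 2) = turn (w i) (w (i + 1)) \<or> w (i + 2) = turn (turn (w i) (w (i + 1))) (w (i + 1))"
    "w (i + 2) = turn (w i) (w (i + 1)) \<longleftrightarrow> w (i + 3) \<noteq> turn (w (i + 1)) (w (i + 2))"
proof -
  have sub: "parcs f \<subseteq> parcs klein_graph" if "f \<in> klein_graph_faces" for f
  proof -
    obtain xs where "f = scyc xs" "parcs (cyc xs) \<subseteq> parcs klein_graph"
      using \<open>f \<in> klein_graph_faces\<close> klein_faceD(2) by (auto simp: cycle_in_def)
    then show ?thesis by (auto simp: parcs_mk_symmetric_with_proj intro: karc_sym)
  qed
  have k: "karc (w i) (w (i + 1))" for i
  proof -
    obtain f where "f \<in> klein_graph_faces" "(w i, w (i + 1)) \<in> parcs f"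
      using w unfolding petrie_walk_def by blast
    then show ?thesis using sub by blast
  qed
  have ne: "w i \<noteq> w (i + 2)" for i using w unfolding petrie_walk_def by blast
  have st: "w (i + 2) = turn (w i) (w (i + 1)) \<or> w (i + 2) = turn (turn (w i) (w (i + 1))) (w (i + 1))" for i
  proof -
    have "w (i + 2) \<in> set (nb (w (i + 1)))"
      using karc_sym[OF k[of "i + 1"]] by (simp add: karc_iff)
    then show ?thesis using karc_turn(2)[OF k[of i]] ne[of i] by auto
  qed
  have nf: "\<not> (\<exists>f\<in>klein_graph_faces. {(w i, w (i + 1)), (w (i + 1), w (i + 2)), (w (i + 2), w (i + 3))} \<subseteq> parcs f)"
    using w unfolding petrie_walk_def by blast
  show "karc (w i) (w (i + 1))"
    "w (i + 2) = turn (w i) (w (i + 1)) \<or> w (i + 2) = turn (turn (w i) (w (i + 1))) (w (i + 1))"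
    by (rule k, rule st)
  show "w (i + 2) = turn (w i) (w (i + 1)) \<longleftrightarrow> w (i + 3) \<noteq> turn (w (i + 1)) (w (i + 2))"
  proof
    assume t: "w (i + 2) = turn (w i) (w (i + 1))"
    show "w (i + 3) \<noteq> turn (w (i + 1)) (w (i + 2))"
    proof
      assume t': "w (i + 3) = turn (w (i + 1)) (w (i + 2))"
      obtain xs where xs: "xs \<in> set klein_faces" "(w i, w (i + 1)) \<in> parcs (cyc xs)"
        using klein_face_ex1[OF k] by blast
      note a = klein_face_turn[OF xs, folded t]
      note b = klein_face_turn[OF xs(1) a, folded t']
      show False using nf xs a b parcs_cyc_subset_scyc[of xs] by blast
    qed
  next
    assume t': "w (i + 3) \<noteq> turn (w (i + 1)) (w (i + 2))"
    show "w (i + 2) = turn (w i) (w (i + 1))"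
    proof (rule ccontr)
      assume "w (i + 2) \<noteq> turn (w i) (w (i + 1))"
      then have "w (i + 2) = turn (turn (w i) (w (i + 1))) (w (i + 1))" using st by blast
      \<comment> \<open>The rotation at a cubic vertex has order three, so a turn against it is a
        turn along it for the reversed walk.\<close>
      then have t: "w i = turn (w (i + 2)) (w (i + 1))" using karc_turn(4)[OF k] by simp
      have e: "i + 1 + 2 = i + 3" "i + 1 + 1 = i + 2" by simp_all
      have k1: "karc (w (i + 1)) (w (i + 2))" using k[of "i + 1"] by (simp add: e)
      have k2: "karc (w (i + 2)) (w (i + 3))" using k[of "i + 2"] by (simp add: numeral_3_eq_3)
      have "w (i + 3) = turn (turn (w (i + 1)) (w (i + 2))) (w (i + 2))"
        using st[of "i + 1", unfolded e] t' by blast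
      then have t2: "w (i + 1) = turn (w (i + 3)) (w (i + 2))" using karc_turn(4)[OF k1] by simp
      obtain xs where xs: "xs \<in> set klein_faces" "(w (i + 3), w (i + 2)) \<in> parcs (cyc xs)"
        using klein_face_ex1[OF karc_sym[OF k2]] by blast
      note a = klein_face_turn[OF xs, folded t2]
      note b = klein_face_turn[OF xs(1) a, folded t]
      show False using nf xs a b by (auto simp: parcs_mk_symmetric_with_proj)
    qed
  qed
qed

lemma klein_petrie_zigzag:
  assumes "petrie_walk klein_graph_faces w"
  shows "zigzag n (w (i + 2) = turn (w i) (w (i + 1))) (w i) (w (i + 1)) = w (i + n)"
proof (induction n arbitrary: i)
  case (Suc n)
  note s = klein_petrie_step[OF assms]
  have "zigzag (Suc n) (w (i + 2) = turn (w i) (w (i + 1))) (w i) (w (i + 1)) =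
      zigzag n (w (i + 2) \<noteq> turn (w i) (w (i + 1))) (w (i + 1)) (w (i + 2))"
    using s(2)[of i] by auto
  also have "(w (i + 2) \<noteq> turn (w i) (w (i + 1))) = (w (i + 3) = turn (w (i + 1)) (w (i + 2)))"
    using s(3)[of i] by blast
  also have "zigzag n (w (i + 3) = turn (w (i + 1)) (w (i + 2))) (w (i + 1)) (w (i + 2)) = w (i + Suc n)"
    using Suc.IH[of "i + 1"] by (simp add: numeral_3_eq_3)
  finally show ?case .
qed simp

lemma klein_petrie_period:
  assumes "petrie_walk klein_graph_faces w"
  shows "has_period w 8"
  unfolding has_period_def
proof (intro conjI allI)
  fix i
  have k: "karc (w i) (w (i + 1))" by (rule klein_petrie_step(1)[OF assms])
  then have "w (i + 1) \<in> set [0..<56]" "w i \<in> set (nb (w (i + 1)))" by (simp_all add: karc_iff)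
  then have "zigzag 8 True (w i) (w (i + 1)) = w i" "zigzag 8 False (w i) (w (i + 1)) = w i"
    using zigzag_check unfolding list_all_iff by blast+
  then have "zigzag 8 b (w i) (w (i + 1)) = w i" for b by (cases b) simp_all
  then show "w (i + 8) = w i" using klein_petrie_zigzag[OF assms, of 8 i] by simp
qed simp

lemma connected_klein_graph: "Digraph_Component.connected (with_proj klein_graph)"
proof -
  interpret pair_graph klein_graph by (rule pair_graph_klein_graph)
  have pv: "pverts klein_graph = {..<56}" by (simp add: klein_graph_def)
  have "0 \<rightarrow>\<^sup>*\<^bsub>with_proj klein_graph\<^esub> v \<and> v \<rightarrow>\<^sup>*\<^bsub>with_proj klein_graph\<^esub> 0" if "v < 56" for v
    using that
  proof (induction v rule: less_induct)
    case (less v)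
    show ?case
    proof (cases "v = 0")
      case True
      then show ?thesis by (simp add: pv)
    next
      case False
      obtain x y z where n: "nb v = [x, y, z]" "v = 0 \<or> x < v \<or> y < v \<or> z < v" by (metis nb_cases less.prems)
      then obtain u where u: "u \<in> set (nb v)" "u < v" using False by auto
      then have k: "karc u v" using less.prems by (simp add: karc_iff)
      have "0 \<rightarrow>\<^sup>*\<^bsub>with_proj klein_graph\<^esub> u \<and> u \<rightarrow>\<^sup>*\<^bsub>with_proj klein_graph\<^esub> 0"
        using less.IH[OF u(2)] u(2) less.prems by simp
      then show ?thesis
        using k karc_sym[OF k] reachable_adj_trans[of 0 u v] adj_reachable_trans[of v u 0] by simp
    qed
  qed
  then have "strongly_connected (with_proj klein_graph)"
    unfolding strongly_connected_def by (auto simp: pv lessThan_empty_iff intro: reachable_trans)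
  then show ?thesis
    unfolding connected_def using reachable_mk_symmetric_eq[OF pair_sym_arcs]
    by (auto simp: strongly_connected_def)
qed

text \<open>Gives the model all conclusions drawn from the rules, girth and regularity included,
  which shows that Klein cubic graphs exist.\<close>

lemma klein_map_rules_klein_graph: "klein_map_rules klein_graph klein_graph_faces"
proof (intro klein_map_rules.intro klein_rules.intro klein_map_rules_axioms.intro
    pair_graph_klein_graph out_degree_klein_graph klein_petrie_period connected_klein_graph)
  interpret pair_graph klein_graph by (rule pair_graph_klein_graph)
  show "klein_graph_faces \<subseteq> copies (cycle_graph 7) klein_graph"
    using klein_faceD(1,2) by (auto simp: copies_cycle_graph[OF pair_sym_digraph_axioms])
  show "card {f \<in> klein_graph_faces. a \<in> parcs f} = 2" if "a \<in> parcs klein_graph" for a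
    using klein_faces_at_arc that by (cases a) simp
  show "card (pverts klein_graph) = 56" by (simp add: klein_graph_def)
qed

lemma card_edges_klein_graph: "card (edges klein_graph) = 84"
proof -
  let ?A = "{(u, v). karc u v \<and> u < v}"
  have fin: "finite (parcs klein_graph)"
    using card_parcs_klein_graph by (metis card.infinite zero_neq_numeral)
  then have finA: "finite ?A" by (rule rev_finite_subset) auto
  have "parcs klein_graph = ?A \<union> ?A\<inverse>"
  proof (intro set_eqI, clarify)
    fix u v
    show "karc u v \<longleftrightarrow> (u, v) \<in> ?A \<union> ?A\<inverse>"
      using karc_sym[of u v] karc_sym[of v u] karc_irrefl[of u] by (cases u v rule: linorder_cases) auto
  qed
  then have "168 = card (?A \<union> ?A\<inverse>)" using card_parcs_klein_graph by simp
  also have "\<dots> = card ?A + card (?A\<inverse>)"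
    by (rule card_Un_disjoint) (use finA in auto)
  finally have "card ?A = 84" by simp
  moreover have "edges klein_graph = (\<lambda>(u, v). {u, v}) ` ?A"
  proof
    show "edges klein_graph \<subseteq> (\<lambda>(u, v). {u, v}) ` ?A"
    proof
      fix e assume "e \<in> edges klein_graph"
      then obtain u v where uv: "e = {u, v}" "karc u v" by (auto simp: edges_def)
      then have "karc v u" "u \<noteq> v" using karc_sym[of u v] karc_irrefl[of u] by auto
      then have "(u, v) \<in> ?A \<or> (v, u) \<in> ?A" using uv(2) by auto
      then show "e \<in> (\<lambda>(u, v). {u, v}) ` ?A"
      proof
        assume "(u, v) \<in> ?A"
        then show ?thesis by (rule rev_image_eqI) (simp add: uv(1))
      next
        assume "(v, u) \<in> ?A"
        then show ?thesis by (rule rev_image_eqI) (simp add: uv(1) insert_commute)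
      qed
    qed
  qed (auto simp: edges_def)
  moreover have "inj_on (\<lambda>(u, v). {u, v}) ?A"
    by (auto simp: inj_on_def doubleton_eq_iff)
  ultimately show ?thesis by (simp add: card_image)
qed

lemma klein_cubic_graph_klein_graph: "klein_cubic_graph klein_graph"
proof -
  interpret K: klein_map_rules klein_graph klein_graph_faces by (rule klein_map_rules_klein_graph)
  show ?thesis
    unfolding klein_cubic_graph_def
    using pair_graph_klein_graph K.card56 card_edges_klein_graph out_degree_klein_graph K.girth7
      K.klein_map_faces by blast
qed

theorem theorem3:
  shows "(\<exists>\<Gamma> :: nat pair_pre_digraph. klein_cubic_graph \<Gamma>) \<and>
    (\<forall>\<Gamma> :: 'a pair_pre_digraph. klein_cubic_graph \<Gamma> \<longrightarrow>
       UH_graph (cycle_graph 7) (path_graph 2) \<Gamma> \<and>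
       UH_digraph (dicycle 7) (dipath 2) \<Gamma> \<and>
       card (copies (cycle_graph 7) \<Gamma>) = 24 \<and>
       (\<exists>D \<subseteq> copies (dicycle 7) \<Gamma>. card D = 24 \<and>
          bij_betw (\<lambda>C. mk_symmetric (with_proj C)) D (copies (cycle_graph 7) \<Gamma>) \<and>
          (\<forall>a \<in> parcs \<Gamma>. \<exists>!C. C \<in> D \<and> a \<in> parcs C)) \<and>
       orientable_map_of_genus 3 \<Gamma> (copies (cycle_graph 7) \<Gamma>) \<and>
       klein_map \<Gamma> (copies (cycle_graph 7) \<Gamma>) \<and>
       (\<forall>F. klein_map \<Gamma> F \<longrightarrow> F = copies (cycle_graph 7) \<Gamma>))"
proof (rule conjI[OF exI[of _ klein_graph]], rule klein_cubic_graph_klein_graph, intro allI impI)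
  fix \<Gamma> :: "'a pair_pre_digraph"
  assume \<Gamma>: "klein_cubic_graph \<Gamma>"
  then obtain F where F: "klein_map \<Gamma> F" by (auto simp: klein_cubic_graph_def)
  interpret K: klein_map_rules \<Gamma> F by (rule klein_map_rules_of_klein_cubic_graph[OF \<Gamma> F])
  obtain \<psi> where \<psi>: "K.labels \<psi>" by (rule K.labels_exist)
  note C = K.copies_eq_faces
  have "orientable_map_of_genus 3 \<Gamma> F"
    using \<Gamma> K.surface_map_faces K.orientable_faces[OF \<psi>] K.card_faces[OF \<psi>]
    by (simp add: orientable_map_of_genus_def klein_cubic_graph_def)
  moreover have "\<exists>D \<subseteq> copies (dicycle 7) \<Gamma>. card D = 24 \<and>
      bij_betw (\<lambda>C. mk_symmetric (with_proj C)) D F \<and> (\<forall>a \<in> parcs \<Gamma>. \<exists>!C. C \<in> D \<and> a \<in> parcs C)"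
    by (intro exI[of _ "K.oriented_faces \<psi>"] conjI ballI K.oriented_faces_subset[OF \<psi>]
        K.card_oriented_faces[OF \<psi>] K.bij_betw_oriented_faces[OF \<psi>] K.oriented_face_ex1[OF \<psi>])
  \<comment> \<open>The faces of any Klein map on \<open>\<Gamma>\<close> obey the same rules and
    hence are all the 7-cycles.\<close>
  moreover have "F' = F" if "klein_map \<Gamma> F'" for F'
    using klein_map_rules.copies_eq_faces[OF klein_map_rules_of_klein_cubic_graph[OF \<Gamma> that]] C by simp
  ultimately show "UH_graph (cycle_graph 7) (path_graph 2) \<Gamma> \<and>
       UH_digraph (dicycle 7) (dipath 2) \<Gamma> \<and>
       card (copies (cycle_graph 7) \<Gamma>) = 24 \<and>
       (\<exists>D \<subseteq> copies (dicycle 7) \<Gamma>. card D = 24 \<and>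
          bij_betw (\<lambda>C. mk_symmetric (with_proj C)) D (copies (cycle_graph 7) \<Gamma>) \<and>
          (\<forall>a \<in> parcs \<Gamma>. \<exists>!C. C \<in> D \<and> a \<in> parcs C)) \<and>
       orientable_map_of_genus 3 \<Gamma> (copies (cycle_graph 7) \<Gamma>) \<and>
       klein_map \<Gamma> (copies (cycle_graph 7) \<Gamma>) \<and>
       (\<forall>F. klein_map \<Gamma> F \<longrightarrow> F = copies (cycle_graph 7) \<Gamma>)"
    unfolding C using K.UH_graph_klein K.UH_digraph_klein K.card_faces[OF \<psi>] K.klein_map_faces by blast
qed

end
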